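(* Let $p>0$ be a constant, let $K:[0,1]\times\mathbb{R}\to\mathbb{R}$ be a function and $L:H^2(0,1)\cap H_0^1(0,1)\to\mathbb{R}$ a functional satisfying $|L(w)|\le\|w\|$ and $|K(x,y)|\le|y|$ for all $x\in[0,1]$, $y\in\mathbb{R}$, $w\in H^2(0,1)\cap H_0^1(0,1)$. Consider the system $$w_t(t,x)=p\,w_{xx}(t,x)+\theta_1(t)K(x,y(t)),\quad w(t,0)=w(t,1)=0,\qquad \dot y=u+\theta_2(t)L(w[t])+d(t),$$ with the controller $$u=-c\Big(1+\frac{(b+\exp(z))^7}{4a^6}\Big)(y^7+y^3+y),\qquad \dot z=\Gamma\exp(-z)\big(y^2/2-\varepsilon\big)^+,$$ where $\varepsilon,\Gamma>0$, $c\ge1$, $b\ge1\ge a>0$ are constants. Let $d\in L^\infty(\mathbb{R}_+)$ and $\theta=(\theta_1,\theta_2)\in C^0(\mathbb{R}_+;\mathbb{R}^2)\cap L^\infty(\mathbb{R}_+;\mathbb{R}^2)$. Let $w\in C^0(\mathbb{R}_+;L^2(0,1))\cap C^1((0,+\infty);L^2(0,1))\cap C^0((0,+\infty);H^2(0,1)\cap H_0^1(0,1))$, $z\in C^1(\mathbb{R}_+;\mathbb{R})$, and $y\in C^0(\mathbb{R}_+;\mathbb{R})$ absolutely continuous on every compact interval of $\mathbb{R}_+$, be such that the PDE, the formula for $u$ and the equation for $\dot z$ hold for all $t\in(0,+\infty)$, and the equation for $\dot y$ holds for a.e. $t\in(0,+\infty)$. Then for all $t\ge0$: $$\|w[t]\|^2+y^2(t)\le\exp(-\kappa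 t)\big(\|w[0]\|^2+y^2(0)\big)+2a\frac{\|d\|_\infty^2+\|\theta\|_\infty^8+2p^{-2}}{b\kappa}+\frac{\|\theta\|_\infty^4}{2p^2\pi^4\kappa},$$ $$z(0)\le z(t)\le\ln\Big(\exp(z(0))+\bar B\big(\|d\|_\infty^2+\|\theta\|_\infty^4+\|\theta\|_\infty^8+2p^{-2}+\|w[0]\|^2+y^2(0)\big)\Big),$$ $$\limsup_{t\to+\infty}\|w[t]\|\le\frac{\sqrt{2\varepsilon}}{p\pi^2}\limsup_{t\to+\infty}|\theta_1(t)|,\qquad \limsup_{t\to+\infty}|y(t)|\le\sqrt{2\varepsilon},$$ where $\kappa=\min\big(\frac{p\pi^2}{2},2c\big)$, $\bar K=\frac{4p\pi^2(b\kappa+ap\pi^2)+2b\kappa p^2\pi^4+b}{4p\pi^2b\kappa}$ and $\bar B=\frac{a\bar K(\varepsilon\Gamma+2c)+\varepsilon c\Gamma}{4c^2\varepsilon}$.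
   Context: $\|\cdot\|$ denotes the norm of $L^2(0,1)$; $w[t]$ denotes the function $x\mapsto w(t,x)$. $H^k(0,1)$ is the Sobolev space and $H_0^1(0,1)$ the closure in $H^1(0,1)$ of compactly supported $C^1$ functions. $\|d\|_\infty$, $\|\theta\|_\infty$ denote essential suprema of $|d(t)|$ and of the Euclidean norm $|\theta(t)|$. $x^+=\max(x,0)$. *)

theory Defs
  imports "HOL-Analysis.Analysis" "HOL-Probability.Essential_Supremum"
begin

definition in_L2 :: "(real \<Rightarrow> real) \<Rightarrow> bool" where
  "in_L2 f \<longleftrightarrow> f \<in> borel_measurable (lebesgue_on {0..1}) \<and>
     integrable (lebesgue_on {0..1}) (\<lambda>x. (f x)^2)"

definition L2norm :: "(real \<Rightarrow> real) \<Rightarrow> real" where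
  "L2norm f = sqrt (integral\<^sup>L (lebesgue_on {0..1}) (\<lambda>x. (f x)^2))"

(* f belongs to H^2(0,1), with f' its (classical = weak) first derivative on [0,1]
   and f'' its weak second derivative: f is C^1 on [0,1], f' is absolutely continuous
   with f'(x) = f'(0) + int_0^x f'', and f'' \<in> L^2(0,1).  (Continuous representative.) *)
definition H2_with :: "(real \<Rightarrow> real) \<Rightarrow> (real \<Rightarrow> real) \<Rightarrow> (real \<Rightarrow> real) \<Rightarrow> bool" where
  "H2_with f f' f'' \<longleftrightarrow>
     (\<forall>x\<in>{0..1}. (f has_real_derivative f' x) (at x within {0..1})) \<and>
     in_L2 f'' \<and>
     (\<forall>x\<in>{0..1}. f' x = f' 0 + integral\<^sup>L (lebesgue_on {0..x}) f'')"

definition H2_H01 :: "(real \<Rightarrow> real) \<Rightarrow> bool" where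
  "H2_H01 f \<longleftrightarrow> (\<exists>f' f''. H2_with f f' f'') \<and> f 0 = 0 \<and> f 1 = 0"

definition L2_continuous_on :: "real set \<Rightarrow> (real \<Rightarrow> real \<Rightarrow> real) \<Rightarrow> bool" where
  "L2_continuous_on S v \<longleftrightarrow> (\<forall>t\<in>S. in_L2 (v t) \<and>
     ((\<lambda>s. L2norm (\<lambda>x. v s x - v t x)) \<longlongrightarrow> 0) (at t within S))"

definition abs_cont_on :: "real \<Rightarrow> real \<Rightarrow> (real \<Rightarrow> real) \<Rightarrow> bool" where
  "abs_cont_on a b f \<longleftrightarrow> (\<forall>e>0. \<exists>\<delta>>0. \<forall>n::nat. \<forall>l r::nat \<Rightarrow> real.
     ((\<forall>i<n. a \<le> l i \<and> l i \<le> r i \<and> r i \<le> b) \<and>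
      (\<forall>i<n. \<forall>j<n. i \<noteq> j \<longrightarrow> r i \<le> l j \<or> r j \<le> l i) \<and>
      (\<Sum>i<n. r i - l i) < \<delta>) \<longrightarrow> (\<Sum>i<n. \<bar>f (r i) - f (l i)\<bar>) < e)"

definition ess_norm :: "(real \<Rightarrow> real) \<Rightarrow> real" where
  "ess_norm g = real_of_ereal (esssup (lebesgue_on {0..}) (\<lambda>t. ereal \<bar>g t\<bar>))"

definition in_Linf :: "(real \<Rightarrow> real) \<Rightarrow> bool" where
  "in_Linf g \<longleftrightarrow> g \<in> borel_measurable (lebesgue_on {0..}) \<and>
     (\<exists>B. AE t in lebesgue_on {0..}. \<bar>g t\<bar> \<le> B)"

end

(*
  Testing the heat equation with w and using the sharp Poincare inequality gives
  (|w|^2)' <= -2 p pi^2 |w|^2 + 2 |theta1| |y| |w|. Young's inequality, paid for by the y^8, y^4, y^2 damping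
  of the controller, turns this into a linear differential inequality for |w|^2 + y^2, and, with that
  bound on |w| inserted, into (y^2/2)' <= -c y^2 + a C / (b + exp z) for a constant C.
  Hence once b + exp z exceeds a C / (2 c eps) the excess of y^2/2 over eps decays exponentially,
  so the gain exp z, whose derivative is Gamma (y^2/2 - eps)^+, stays bounded. Boundedness of the
  gain forces limsup y^2/2 <= eps by Barbalat's argument, and the energy inequality for w
  yields the remaining limit superior.
*)

theory Submission
  imports Defs
begin

subsection \<open>Square-integrable functions on the unit interval\<close>

text \<open>The powers in the controller answer the Young inequalities. With a weight
  \<open>r\<close> they leave residues of size \<open>1 / r\<close> and terms in \<open>y\<close>
  whose coefficients grow up to \<open>r^3\<close>; the gain
  \<open>B^7 / a^6 = B * (B / a)^6\<close>, where \<open>B = b + exp z\<close>, dominates those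
  coefficients. The weight is chosen twice. With \<open>r = b / a\<close> the residues do not depend
  on the gain, which gives the decay estimate. With \<open>r = B / a\<close> the residue fades as
  the gain grows, which is what stops the adaptation. The obstacle is low regularity:
  \<open>y\<close> is only absolutely continuous with an equation valid almost everywhere, and the
  squared norm of \<open>w\<close> is differentiable only for positive times. The differential
  inequalities for both are therefore integrated by a monotonicity theorem for absolutely continuous
  functions with a negligible exceptional set, and Gronwall's inequality starts at a point where
  only continuity is available.\<close>

lemma in_L2_mult_integrable:
  assumes "in_L2 f" "in_L2 g"
  shows "integrable (lebesgue_on {0..1}) (\<lambda>x. f x * g x)"
proof (rule Bochner_Integration.integrable_bound)
  show "integrable (lebesgue_on {0..1}) (\<lambda>x. (f x)^2 + (g x)^2)"
    using assms unfolding in_L2_def by (intro Bochner_Integration.integrable_add) auto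
  show "(\<lambda>x. f x * g x) \<in> borel_measurable (lebesgue_on {0..1})"
    using assms unfolding in_L2_def by (intro borel_measurable_times) auto
  have "\<bar>f x * g x\<bar> \<le> (f x)^2 + (g x)^2" for x
    using sum_squares_bound[of "\<bar>f x\<bar>" "\<bar>g x\<bar>"] mult_nonneg_nonneg[of "\<bar>f x\<bar>" "\<bar>g x\<bar>"]
    unfolding abs_mult power2_abs by linarith
  then show "AE x in lebesgue_on {0..1}. norm (f x * g x) \<le> norm ((f x)^2 + (g x)^2)"
    by (intro AE_I2) (auto intro: order_trans)
qed

lemma in_L2_add:
  assumes "in_L2 f" "in_L2 g"
  shows "in_L2 (\<lambda>x. f x + g x)"
proof -
  have "integrable (lebesgue_on {0..1}) (\<lambda>x. (f x)^2 + (g x)^2 + 2 * (f x * g x))"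
    using assms in_L2_mult_integrable[OF assms] unfolding in_L2_def
    by (intro Bochner_Integration.integrable_add integrable_mult_right) auto
  then show ?thesis
    using assms unfolding in_L2_def by (auto simp: power2_sum algebra_simps)
qed

lemma in_L2_cmult: "in_L2 f \<Longrightarrow> in_L2 (\<lambda>x. k * f x)"
  unfolding in_L2_def by (auto simp: power_mult_distrib)

lemma in_L2_diff:
  assumes "in_L2 f" "in_L2 g"
  shows "in_L2 (\<lambda>x. f x - g x)"
  using in_L2_add[OF assms(1) in_L2_cmult[OF assms(2), of "-1"]] by simp

lemma L2norm_nonneg: "L2norm f \<ge> 0"
  unfolding L2norm_def by (intro real_sqrt_ge_zero integral_nonneg_AE) auto

lemma L2norm_power2: "(L2norm f)^2 = integral\<^sup>L (lebesgue_on {0..1}) (\<lambda>x. (f x)^2)"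
  unfolding L2norm_def by (intro real_sqrt_pow2 integral_nonneg_AE) auto

lemma L2norm_cmult: "L2norm (\<lambda>x. k * f x) = \<bar>k\<bar> * L2norm f"
  unfolding L2norm_def by (simp add: power_mult_distrib real_sqrt_mult)

lemma L2_Cauchy_Schwarz:
  assumes "in_L2 f" "in_L2 g"
  shows "\<bar>integral\<^sup>L (lebesgue_on {0..1}) (\<lambda>x. f x * g x)\<bar> \<le> L2norm f * L2norm g"
proof -
  let ?M = "lebesgue_on {0..1::real}"
  define I where "I = integral\<^sup>L ?M (\<lambda>x. f x * g x)"
  note fg = in_L2_mult_integrable[OF assms]
  have ff: "integrable ?M (\<lambda>x. (f x)^2)" and gg: "integrable ?M (\<lambda>x. (g x)^2)"
    using assms unfolding in_L2_def by auto
  have quad: "0 \<le> s^2 * (L2norm f)^2 - 2 * s * r * I + r^2 * (L2norm g)^2" for s r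
  proof -
    have "0 \<le> integral\<^sup>L ?M (\<lambda>x. (s * f x - r * g x)^2)"
      by (intro integral_nonneg_AE) auto
    also have "(\<lambda>x. (s * f x - r * g x)^2) = (\<lambda>x. s^2 * (f x)^2 - (2 * s * r) * (f x * g x) + r^2 * (g x)^2)"
      by (auto simp: power2_eq_square algebra_simps)
    also have "integral\<^sup>L ?M \<dots> = s^2 * (L2norm f)^2 - 2 * s * r * I + r^2 * (L2norm g)^2"
      unfolding L2norm_power2 I_def
      using ff fg gg by simp
    finally show ?thesis .
  qed
  have "I^2 \<le> (L2norm f)^2 * (L2norm g)^2"
  proof (cases "L2norm g = 0")
    case True
    have "I = 0"
    proof (rule ccontr)
      assume "I \<noteq> 0"
      \<comment> \<open>The chosen values make the form equal to \<open>-1\<close>.\<close>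
      then show False
        using quad[of 1 "((L2norm f)^2 + 1) / (2 * I)"] True by simp
    qed
    then show ?thesis by simp
  next
    case False
    then have "(L2norm g)^2 > 0" by simp
    \<comment> \<open>The form is evaluated at the residual of projecting \<open>f\<close> onto
      \<open>g\<close>, cleared of its denominator.\<close>
    moreover have "0 \<le> (L2norm g)^2 * ((L2norm f)^2 * (L2norm g)^2 - I^2)"
      using quad[of "(L2norm g)^2" I] by (simp add: power2_eq_square algebra_simps)
    ultimately show ?thesis
      by (simp add: zero_le_mult_iff)
  qed
  then have "\<bar>I\<bar>^2 \<le> (L2norm f * L2norm g)^2"
    by (simp add: power_mult_distrib)
  then show ?thesis
    unfolding I_def by (rule power2_le_imp_le) (simp add: L2norm_nonneg)
qed

lemma L2norm_add_power2:
  assumes "in_L2 f" "in_L2 g"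
  shows "(L2norm (\<lambda>x. f x + g x))^2 =
    (L2norm f)^2 + 2 * integral\<^sup>L (lebesgue_on {0..1}) (\<lambda>x. f x * g x) + (L2norm g)^2"
proof -
  have "(\<lambda>x. (f x + g x)^2) = (\<lambda>x. (f x)^2 + 2 * (f x * g x) + (g x)^2)"
    by (auto simp: power2_sum)
  then show ?thesis
    using assms in_L2_mult_integrable[OF assms] unfolding L2norm_power2 in_L2_def by simp
qed

lemma L2norm_triangle:
  assumes "in_L2 f" "in_L2 g"
  shows "L2norm (\<lambda>x. f x + g x) \<le> L2norm f + L2norm g"
proof (rule power2_le_imp_le)
  show "(L2norm (\<lambda>x. f x + g x))\<^sup>2 \<le> (L2norm f + L2norm g)\<^sup>2"
    unfolding L2norm_add_power2[OF assms] power2_sum using L2_Cauchy_Schwarz[OF assms] by simp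
qed (simp add: L2norm_nonneg)

lemma L2norm_triangle_diff:
  assumes "in_L2 f" "in_L2 g"
  shows "\<bar>L2norm f - L2norm g\<bar> \<le> L2norm (\<lambda>x. f x - g x)"
proof -
  have "L2norm f \<le> L2norm (\<lambda>x. f x - g x) + L2norm g"
    using L2norm_triangle[OF in_L2_diff[OF assms] assms(2)] by simp
  moreover have "L2norm g \<le> L2norm (\<lambda>x. g x - f x) + L2norm f"
    using L2norm_triangle[OF in_L2_diff[OF assms(2,1)] assms(1)] by simp
  moreover have "L2norm (\<lambda>x. g x - f x) = L2norm (\<lambda>x. f x - g x)"
    using L2norm_cmult[of "-1" "\<lambda>x. f x - g x"] by simp
  ultimately show ?thesis by linarith
qed

lemma L2_continuous_on_norm:
  assumes "L2_continuous_on S v"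
  shows "continuous_on S (\<lambda>t. L2norm (v t))"
  unfolding continuous_on_def
proof
  fix t assume t: "t \<in> S"
  have "((\<lambda>s. L2norm (v s) - L2norm (v t)) \<longlongrightarrow> 0) (at t within S)"
  proof (rule Lim_null_comparison)
    show "((\<lambda>s. L2norm (\<lambda>x. v s x - v t x)) \<longlongrightarrow> 0) (at t within S)"
      using assms t unfolding L2_continuous_on_def by auto
    show "\<forall>\<^sub>F s in at t within S. norm (L2norm (v s) - L2norm (v t)) \<le> L2norm (\<lambda>x. v s x - v t x)"
      using assms t unfolding L2_continuous_on_def eventually_at_filter
      by (auto intro!: always_eventually L2norm_triangle_diff)
  qed
  then show "((\<lambda>s. L2norm (v s)) \<longlongrightarrow> L2norm (v t)) (at t within S)"
    by (rule LIM_zero_cancel)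
qed

text \<open>With \<open>h = w s - w t\<close>, the difference quotient of the squared norm minus its limit is
  \<open>2 \<langle>w t, h / (s - t) - w'\<rangle> + \<langle>h, h\<rangle> / (s - t)\<close>.\<close>

lemma L2norm_power2_has_derivative:
  assumes w: "\<And>s. s > 0 \<Longrightarrow> in_L2 (w s)" and t: "t > 0" and w': "in_L2 w'"
    and lim: "((\<lambda>s. L2norm (\<lambda>x. (w s x - w t x) / (s - t) - w' x)) \<longlongrightarrow> 0) (at t)"
  shows "((\<lambda>s. (L2norm (w s))^2) has_real_derivative
    2 * integral\<^sup>L (lebesgue_on {0..1}) (\<lambda>x. w t x * w' x)) (at t)"
  unfolding has_field_derivative_iff
proof (rule Lim_null[THEN iffD2], rule Lim_null_comparison)
  define r where "r s = L2norm (\<lambda>x. (w s x - w t x) / (s - t) - w' x)" for s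
  let ?b = "\<lambda>s. 2 * L2norm (w t) * r s + \<bar>s - t\<bar> * (r s + L2norm w')^2"
  have "(?b \<longlongrightarrow> 2 * L2norm (w t) * 0 + \<bar>t - t\<bar> * (0 + L2norm w')^2) (at t)"
    using lim unfolding r_def by (intro tendsto_intros)
  then show "(?b \<longlongrightarrow> 0) (at t)" by simp
  have "\<forall>\<^sub>F s in at t. s > 0"
    using t by (intro order_tendstoD[OF tendsto_ident_at])
  moreover have "\<forall>\<^sub>F s in at t. s \<noteq> t"
    by (simp add: eventually_at_filter)
  ultimately show "\<forall>\<^sub>F s in at t. norm (((L2norm (w s))^2 - (L2norm (w t))^2) / (s - t)
      - 2 * integral\<^sup>L (lebesgue_on {0..1}) (\<lambda>x. w t x * w' x)) \<le> ?b s"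
  proof eventually_elim
    case (elim s)
    define k where "k = (\<lambda>x. (w s x - w t x) / (s - t))"
    have k: "in_L2 k"
      using in_L2_cmult[OF in_L2_diff[OF w[OF \<open>s > 0\<close>] w[OF t]], of "1 / (s - t)"]
      unfolding k_def by simp
    have e: "in_L2 (\<lambda>x. k x - w' x)"
      by (intro in_L2_diff k w')
    have kn: "L2norm k \<le> r s + L2norm w'"
      using L2norm_triangle[OF e w'] unfolding r_def k_def by simp
    have ws: "w s = (\<lambda>x. w t x + (s - t) * k x)"
      using \<open>s \<noteq> t\<close> unfolding k_def by auto
    have "(L2norm (w s))^2 = (L2norm (w t))^2
        + 2 * integral\<^sup>L (lebesgue_on {0..1}) (\<lambda>x. w t x * ((s - t) * k x)) + (s - t)^2 * (L2norm k)^2"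
      unfolding ws L2norm_add_power2[OF w[OF t] in_L2_cmult[OF k]] L2norm_cmult
      by (simp add: power_mult_distrib)
    also have "integral\<^sup>L (lebesgue_on {0..1}) (\<lambda>x. w t x * ((s - t) * k x))
        = (s - t) * integral\<^sup>L (lebesgue_on {0..1}) (\<lambda>x. w t x * k x)"
      by (subst integral_mult_right_zero[symmetric]) (simp add: algebra_simps)
    finally have q: "((L2norm (w s))^2 - (L2norm (w t))^2) / (s - t)
        = 2 * integral\<^sup>L (lebesgue_on {0..1}) (\<lambda>x. w t x * k x) + (s - t) * (L2norm k)^2"
      using \<open>s \<noteq> t\<close> by (simp add: field_simps power2_eq_square)
    have "integral\<^sup>L (lebesgue_on {0..1}) (\<lambda>x. w t x * k x) - integral\<^sup>L (lebesgue_on {0..1}) (\<lambda>x. w t x * w' x)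
        = integral\<^sup>L (lebesgue_on {0..1}) (\<lambda>x. w t x * (k x - w' x))"
      using in_L2_mult_integrable[OF w[OF t] k] in_L2_mult_integrable[OF w[OF t] w']
      by (simp add: right_diff_distrib)
    moreover have "\<bar>\<dots>\<bar> \<le> L2norm (w t) * r s"
      using L2_Cauchy_Schwarz[OF w[OF t] e] unfolding r_def k_def .
    moreover have "\<bar>(s - t) * (L2norm k)^2\<bar> \<le> \<bar>s - t\<bar> * (r s + L2norm w')^2"
      using kn by (auto simp: abs_mult intro!: mult_left_mono power_mono L2norm_nonneg)
    ultimately show ?case
      unfolding q real_norm_def by linarith
  qed
qed

subsection \<open>Absolutely continuous functions\<close>

text \<open>Reduces closure properties to a bound on increments: sums, products, half squares and,
  by comparison with the identity, Lipschitz functions.\<close>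

lemma abs_cont_on_dominated:
  assumes f: "abs_cont_on a b f" and g: "abs_cont_on a b g"
    and h: "\<And>s t. a \<le> s \<Longrightarrow> s \<le> t \<Longrightarrow> t \<le> b \<Longrightarrow> \<bar>h t - h s\<bar> \<le> C * (\<bar>f t - f s\<bar> + \<bar>g t - g s\<bar>)"
  shows "abs_cont_on a b h"
  unfolding abs_cont_on_def
proof (intro allI impI)
  fix e :: real assume "e > 0"
  define C' where "C' = max C 1"
  have "C' > 0" "C \<le> C'" unfolding C'_def by auto
  define e' where "e' = e / (2 * C')"
  have "e' > 0" using \<open>e > 0\<close> \<open>C' > 0\<close> unfolding e'_def by simp
  obtain d1 where "d1 > 0" and d1: "\<forall>n::nat. \<forall>l r::nat \<Rightarrow> real.
     ((\<forall>i<n. a \<le> l i \<and> l i \<le> r i \<and> r i \<le> b) \<and>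
      (\<forall>i<n. \<forall>j<n. i \<noteq> j \<longrightarrow> r i \<le> l j \<or> r j \<le> l i) \<and>
      (\<Sum>i<n. r i - l i) < d1) \<longrightarrow> (\<Sum>i<n. \<bar>f (r i) - f (l i)\<bar>) < e'"
    using f \<open>e' > 0\<close> unfolding abs_cont_on_def by blast
  obtain d2 where "d2 > 0" and d2: "\<forall>n::nat. \<forall>l r::nat \<Rightarrow> real.
     ((\<forall>i<n. a \<le> l i \<and> l i \<le> r i \<and> r i \<le> b) \<and>
      (\<forall>i<n. \<forall>j<n. i \<noteq> j \<longrightarrow> r i \<le> l j \<or> r j \<le> l i) \<and>
      (\<Sum>i<n. r i - l i) < d2) \<longrightarrow> (\<Sum>i<n. \<bar>g (r i) - g (l i)\<bar>) < e'"
    using g \<open>e' > 0\<close> unfolding abs_cont_on_def by blast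
  show "\<exists>\<delta>>0. \<forall>n::nat. \<forall>l r::nat \<Rightarrow> real.
     ((\<forall>i<n. a \<le> l i \<and> l i \<le> r i \<and> r i \<le> b) \<and>
      (\<forall>i<n. \<forall>j<n. i \<noteq> j \<longrightarrow> r i \<le> l j \<or> r j \<le> l i) \<and>
      (\<Sum>i<n. r i - l i) < \<delta>) \<longrightarrow> (\<Sum>i<n. \<bar>h (r i) - h (l i)\<bar>) < e"
  proof (intro exI[of _ "min d1 d2"] conjI allI impI)
    show "min d1 d2 > 0" using \<open>d1 > 0\<close> \<open>d2 > 0\<close> by simp
    fix n :: nat and l r :: "nat \<Rightarrow> real"
    assume A: "(\<forall>i<n. a \<le> l i \<and> l i \<le> r i \<and> r i \<le> b) \<and>
      (\<forall>i<n. \<forall>j<n. i \<noteq> j \<longrightarrow> r i \<le> l j \<or> r j \<le> l i) \<and> (\<Sum>i<n. r i - l i) < min d1 d2"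
    have "(\<Sum>i<n. \<bar>h (r i) - h (l i)\<bar>) \<le> (\<Sum>i<n. C' * (\<bar>f (r i) - f (l i)\<bar> + \<bar>g (r i) - g (l i)\<bar>))"
    proof (rule sum_mono)
      fix i assume "i \<in> {..<n}"
      then have "\<bar>h (r i) - h (l i)\<bar> \<le> C * (\<bar>f (r i) - f (l i)\<bar> + \<bar>g (r i) - g (l i)\<bar>)"
        using A h by auto
      also have "\<dots> \<le> C' * (\<bar>f (r i) - f (l i)\<bar> + \<bar>g (r i) - g (l i)\<bar>)"
        using \<open>C \<le> C'\<close> by (intro mult_right_mono) auto
      finally show "\<bar>h (r i) - h (l i)\<bar> \<le> C' * (\<bar>f (r i) - f (l i)\<bar> + \<bar>g (r i) - g (l i)\<bar>)" .
    qed
    also have "\<dots> = C' * ((\<Sum>i<n. \<bar>f (r i) - f (l i)\<bar>) + (\<Sum>i<n. \<bar>g (r i) - g (l i)\<bar>))"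
      by (simp only: sum_distrib_left[symmetric] sum.distrib)
    also have "\<dots> < C' * (e' + e')"
      using A d1 d2 \<open>C' > 0\<close> by (intro mult_strict_left_mono add_strict_mono) auto
    also have "\<dots> = e" using \<open>C' > 0\<close> unfolding e'_def by simp
    finally show "(\<Sum>i<n. \<bar>h (r i) - h (l i)\<bar>) < e" .
  qed
qed

lemma abs_cont_on_lipschitz:
  assumes "\<And>s t. a \<le> s \<Longrightarrow> s \<le> t \<Longrightarrow> t \<le> b \<Longrightarrow> \<bar>f t - f s\<bar> \<le> C * (t - s)"
  shows "abs_cont_on a b f"
proof -
  have id: "abs_cont_on a b (\<lambda>t. t)"
    unfolding abs_cont_on_def
  proof (intro allI impI)
    fix e :: real assume "e > 0"
    then show "\<exists>\<delta>>0. \<forall>n::nat. \<forall>l r::nat \<Rightarrow> real.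
     ((\<forall>i<n. a \<le> l i \<and> l i \<le> r i \<and> r i \<le> b) \<and>
      (\<forall>i<n. \<forall>j<n. i \<noteq> j \<longrightarrow> r i \<le> l j \<or> r j \<le> l i) \<and>
      (\<Sum>i<n. r i - l i) < \<delta>) \<longrightarrow> (\<Sum>i<n. \<bar>r i - l i\<bar>) < e"
      by (intro exI[of _ e]) auto
  qed
  show ?thesis
  proof (rule abs_cont_on_dominated[OF id id])
    fix s t :: real assume st: "a \<le> s" "s \<le> t" "t \<le> b"
    have "\<bar>f t - f s\<bar> \<le> C * (t - s)" using assms st by blast
    also have "\<dots> = C / 2 * (\<bar>t - s\<bar> + \<bar>t - s\<bar>)" using st by simp
    finally show "\<bar>f t - f s\<bar> \<le> C / 2 * (\<bar>t - s\<bar> + \<bar>t - s\<bar>)" .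
  qed
qed

lemma abs_cont_on_add:
  assumes "abs_cont_on a b f" "abs_cont_on a b g"
  shows "abs_cont_on a b (\<lambda>t. f t + g t)"
proof (rule abs_cont_on_dominated[OF assms])
  show "\<bar>f t + g t - (f s + g s)\<bar> \<le> 1 * (\<bar>f t - f s\<bar> + \<bar>g t - g s\<bar>)" for s t
    by simp
qed

lemma abs_cont_on_mult:
  assumes f: "abs_cont_on a b f" "continuous_on {a..b} f"
    and g: "abs_cont_on a b g" "continuous_on {a..b} g"
  shows "abs_cont_on a b (\<lambda>t. f t * g t)"
proof -
  have "bounded (f ` {a..b})" "bounded (g ` {a..b})"
    using f(2) g(2) by (auto intro: compact_imp_bounded compact_continuous_image)
  then obtain F G where F: "\<And>t. t \<in> {a..b} \<Longrightarrow> \<bar>f t\<bar> \<le> F" and G: "\<And>t. t \<in> {a..b} \<Longrightarrow> \<bar>g t\<bar> \<le> G"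
    unfolding bounded_iff by (metis imageI real_norm_def)
  show ?thesis
  proof (rule abs_cont_on_dominated[OF f(1) g(1)])
    fix s t assume st: "a \<le> s" "s \<le> t" "t \<le> b"
    then have "F \<ge> 0" "G \<ge> 0" using F[of s] G[of s] by auto
    have "\<bar>f t * g t - f s * g s\<bar> = \<bar>g t * (f t - f s) + f s * (g t - g s)\<bar>"
      by (simp add: algebra_simps)
    also have "\<dots> \<le> \<bar>g t\<bar> * \<bar>f t - f s\<bar> + \<bar>f s\<bar> * \<bar>g t - g s\<bar>"
      by (metis abs_mult abs_triangle_ineq)
    also have "\<dots> \<le> (F + G) * \<bar>f t - f s\<bar> + (F + G) * \<bar>g t - g s\<bar>"
      using F[of s] G[of t] st \<open>F \<ge> 0\<close> \<open>G \<ge> 0\<close> by (intro add_mono mult_right_mono) auto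
    finally show "\<bar>f t * g t - f s * g s\<bar> \<le> (F + G) * (\<bar>f t - f s\<bar> + \<bar>g t - g s\<bar>)"
      by (simp add: distrib_left)
  qed
qed

text \<open>Cousin's lemma yields a tagged division on which the increments at tags off \<open>N\<close> are
  controlled by the derivative, while the intervals tagged in \<open>N\<close> have small total length.\<close>

lemma abs_cont_on_nonincreasing:
  assumes ac: "abs_cont_on a b f" and "a \<le> b" and N: "negligible N"
    and deriv: "\<And>t. t \<in> {a..b} - N \<Longrightarrow> \<exists>D\<le>0. (f has_real_derivative D) (at t)"
  shows "f b \<le> f a"
proof (rule field_le_epsilon)
  fix e0 :: real assume "e0 > 0"
  \<comment> \<open>Intervals tagged off \<open>N\<close> will contribute at most
    \<open>e * (b - a)\<close>, those tagged in \<open>N\<close> less than \<open>e\<close>.\<close>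
  define e where "e = e0 / (1 + (b - a))"
  have "e > 0" using \<open>e0 > 0\<close> \<open>a \<le> b\<close> unfolding e_def by simp
  obtain \<delta> where "\<delta> > 0" and \<delta>: "\<forall>n::nat. \<forall>l r::nat \<Rightarrow> real.
     ((\<forall>i<n. a \<le> l i \<and> l i \<le> r i \<and> r i \<le> b) \<and>
      (\<forall>i<n. \<forall>j<n. i \<noteq> j \<longrightarrow> r i \<le> l j \<or> r j \<le> l i) \<and>
      (\<Sum>i<n. r i - l i) < \<delta>) \<longrightarrow> (\<Sum>i<n. \<bar>f (r i) - f (l i)\<bar>) < e"
    using ac \<open>e > 0\<close> unfolding abs_cont_on_def by blast
  obtain U where U: "open U" "N \<subseteq> U" "U \<in> lmeasurable" "measure lebesgue U < \<delta>"
  proof -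
    have N0: "N \<in> null_sets lebesgue" using N by (simp add: negligible_iff_null_sets)
    obtain U where U: "open U" "N \<subseteq> U" "U - N \<in> lmeasurable" "emeasure lebesgue (U - N) < ennreal \<delta>"
      using sets_lebesgue_outer_open[OF negligible_imp_sets[OF N] \<open>\<delta> > 0\<close>] by blast
    have eq: "U = (U - N) \<union> N" using U(2) by auto
    have "U \<in> lmeasurable"
      using fmeasurable.Un[OF U(3) negligible_imp_measurable[OF N]] eq by simp
    moreover have "measure lebesgue U = measure lebesgue (U - N)"
      using measure_Un_null_set[OF fmeasurableD[OF U(3)] N0] eq by simp
    moreover have "measure lebesgue (U - N) < \<delta>"
      using U(3,4) \<open>\<delta> > 0\<close> by (simp add: emeasure_eq_measure2 ennreal_less_iff)
    ultimately show thesis using U that by auto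
  qed
  \<comment> \<open>Straddle estimate: the errors at \<open>l\<close> and \<open>r\<close> add up to
    at most \<open>e * (r - l)\<close> because the tag lies between them, and the linear part is
    nonpositive since \<open>D \<le> 0\<close>.\<close>
  have "\<exists>d>0. t \<in> {a..b} - N \<longrightarrow> (\<forall>l r. l \<le> t \<and> t \<le> r \<and> {l..r} \<subseteq> ball t d \<longrightarrow> f r - f l \<le> e * (r - l))" for t
  proof (cases "t \<in> {a..b} - N")
    case True
    then obtain D where "D \<le> 0" and D: "(f has_real_derivative D) (at t)" using deriv by blast
    from D have "(f has_derivative (\<lambda>h. D * h)) (at t)" by (simp add: has_field_derivative_def)
    then obtain d where "d > 0" and d: "\<And>s. norm (s - t) < d \<Longrightarrow> norm (f s - f t - D * (s - t)) \<le> e * norm (s - t)"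
      using \<open>e > 0\<close> unfolding has_derivative_at_alt by blast
    have "f r - f l \<le> e * (r - l)" if "l \<le> t" "t \<le> r" "{l..r} \<subseteq> ball t d" for l r
    proof -
      have "l \<in> ball t d" "r \<in> ball t d" using that(1,2) by (auto intro!: subsetD[OF that(3)] simp del: mem_ball)
      then have "norm (f r - f t - D * (r - t)) \<le> e * norm (r - t)" "norm (f l - f t - D * (l - t)) \<le> e * norm (l - t)"
        by (intro d; simp add: dist_real_def abs_minus_commute)+
      then have "f r - f t - D * (r - t) \<le> e * (r - t)" "- (f l - f t - D * (l - t)) \<le> e * (t - l)"
        using that by auto
      moreover have "D * (r - t) \<le> 0" "D * (t - l) \<le> 0"
        using \<open>D \<le> 0\<close> that by (auto simp: mult_nonpos_nonneg)
      ultimately show ?thesis by (simp add: algebra_simps)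
    qed
    then show ?thesis using \<open>d > 0\<close> by blast
  qed (auto intro: zero_less_one)
  then obtain d where d0: "\<And>t. d t > 0"
    and d: "\<And>t l r. t \<in> {a..b} - N \<Longrightarrow> l \<le> t \<Longrightarrow> t \<le> r \<Longrightarrow> {l..r} \<subseteq> ball t (d t) \<Longrightarrow> f r - f l \<le> e * (r - l)"
    by metis
  \<comment> \<open>At tags in \<open>N\<close> the gauge is all of \<open>U\<close>, so the
    intervals tagged there lie in an open set of measure below \<open>\<delta>\<close>.\<close>
  define \<gamma> where "\<gamma> t = (if t \<in> N then U else ball t (d t))" for t
  have "gauge \<gamma>"
    unfolding gauge_def \<gamma>_def using U d0 by auto
  then obtain P where P: "P tagged_division_of {a..b}" "\<gamma> fine P"
    using fine_division_exists_real by blast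
  note PD = tagged_division_ofD[OF P(1)]
  have PK: "\<exists>l r. K = {l..r} \<and> l \<le> x \<and> x \<le> r \<and> a \<le> l \<and> r \<le> b \<and> Inf K = l \<and> Sup K = r \<and> K \<subseteq> \<gamma> x"
    if xK: "(x, K) \<in> P" for x K
  proof -
    obtain l r where K: "K = {l..r}" using PD(4)[OF xK] by auto
    moreover have "x \<in> K" "K \<subseteq> {a..b}" using PD(2,3)[OF xK] by auto
    ultimately show ?thesis using P(2) xK unfolding fine_def by (intro exI[of _ l] exI[of _ r]) auto
  qed
  \<comment> \<open>Degenerate intervals are left out: their increment is zero, and a single point
    inside another interval has empty interior, so disjoint interiors would not yield the ordering
    that \<open>abs_cont_on\<close> asks for.\<close>
  define Q where "Q = {(x, K) \<in> P. x \<in> N \<and> Inf K < Sup K}"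
  have "finite Q" using PD(1) unfolding Q_def by (rule finite_subset[rotated]) auto
  let ?inc = "\<lambda>(x, K). f (Sup K) - f (Inf K)"
  have split: "?inc xK \<le> e * (Sup (snd xK) - Inf (snd xK)) + (if xK \<in> Q then \<bar>?inc xK\<bar> else 0)"
    if xKP: "xK \<in> P" for xK
  proof -
    obtain x K where xK: "xK = (x, K)" by fastforce
    obtain l r where K: "K = {l..r}" "l \<le> x" "x \<le> r" "a \<le> l" "r \<le> b" "Inf K = l" "Sup K = r" "K \<subseteq> \<gamma> x"
      using PK xKP xK by blast
    have "x \<notin> N \<Longrightarrow> f r - f l \<le> e * (r - l)"
      using K d[of x l r] unfolding \<gamma>_def by auto
    moreover have "0 \<le> e * (r - l)" using K \<open>e > 0\<close> by auto
    moreover have "xK \<in> Q \<longleftrightarrow> x \<in> N \<and> l < r" using xKP K unfolding xK Q_def by auto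
    ultimately show ?thesis using K(2,3) unfolding xK by (cases "l = r") (auto simp: K(6,7))
  qed
  have "f b - f a = (\<Sum>xK\<in>P. ?inc xK)"
    using additive_tagged_division_1[OF \<open>a \<le> b\<close> P(1), of f] by simp
  also have "\<dots> \<le> (\<Sum>xK\<in>P. e * (Sup (snd xK) - Inf (snd xK)) + (if xK \<in> Q then \<bar>?inc xK\<bar> else 0))"
    by (rule sum_mono) (rule split)
  also have "\<dots> = e * (\<Sum>(x, K)\<in>P. Sup K - Inf K) + (\<Sum>xK\<in>Q. \<bar>?inc xK\<bar>)"
  proof -
    have "P \<inter> Q = Q" unfolding Q_def by auto
    then show ?thesis
      using PD(1) by (simp add: sum.distrib sum_distrib_left sum.If_cases case_prod_beta')
  qed
  also have "(\<Sum>(x, K)\<in>P. Sup K - Inf K) = b - a"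
    using additive_tagged_division_1[OF \<open>a \<le> b\<close> P(1), of "\<lambda>t. t"] .
  also have "(\<Sum>xK\<in>Q. \<bar>?inc xK\<bar>) < e"
  proof -
    obtain h where h: "bij_betw h {0..<card Q} Q" using ex_bij_betw_nat_finite[OF \<open>finite Q\<close>] by blast
    define n where "n = card Q"
    define l r where "l i = Inf (snd (h i))" and "r i = Sup (snd (h i))" for i
    have hQ: "h i \<in> Q" if "i < n" for i using h that unfolding n_def bij_betw_def by auto
    have hne: "h i \<noteq> h j" if "i < n" "j < n" "i \<noteq> j" for i j
      using h that unfolding n_def bij_betw_def inj_on_def by auto
    have lr: "snd (h i) = {l i..r i} \<and> a \<le> l i \<and> l i < r i \<and> r i \<le> b \<and> {l i..r i} \<subseteq> U" if "i < n" for i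
    proof -
      obtain x K where xK: "h i = (x, K)" by fastforce
      then have "(x, K) \<in> P" "x \<in> N" "Inf K < Sup K" using hQ[OF that] unfolding Q_def by auto
      then show ?thesis using PK[of x K] xK unfolding l_def r_def \<gamma>_def by auto
    qed
    have disj: "{l i<..<r i} \<inter> {l j<..<r j} = {}" if "i < n" "j < n" "i \<noteq> j" for i j
    proof -
      have "Q \<subseteq> P" unfolding Q_def by auto
      then have "h i \<in> P" "h j \<in> P" using hQ that by auto
      then have "interior (snd (h i)) \<inter> interior (snd (h j)) = {}"
        using PD(5)[of "fst (h i)" "snd (h i)" "fst (h j)" "snd (h j)"] hne[OF that] by auto
      then show ?thesis using lr that by (simp add: interior_atLeastAtMost_real)
    qed
    have ord: "r i \<le> l j \<or> r j \<le> l i" if "i < n" "j < n" "i \<noteq> j" for i j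
    proof (rule ccontr)
      assume "\<not> ?thesis"
      then have "max (l i) (l j) < min (r i) (r j)" using lr that by auto
      then obtain m where "max (l i) (l j) < m" "m < min (r i) (r j)" using dense by blast
      then show False using disj[OF that] by auto
    qed
    have "(\<Sum>i<n. r i - l i) = (\<Sum>i<n. measure lebesgue {l i<..<r i})"
      using lr by (intro sum.cong) (auto simp: measure_completion measure_lborel_Ioo less_imp_le)
    also have "\<dots> = measure lebesgue (\<Union>i<n. {l i<..<r i})"
      using disj by (intro measure_UNION'[symmetric]) (auto simp: pairwise_def disjnt_def)
    also have "\<dots> \<le> measure lebesgue U"
    proof (rule measure_mono_fmeasurable)
      show "(\<Union>i<n. {l i<..<r i}) \<subseteq> U" using lr by fastforce
    qed (use U in auto)
    also have "\<dots> < \<delta>" by fact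
    finally have "(\<Sum>i<n. \<bar>f (r i) - f (l i)\<bar>) < e"
      using lr ord by (intro \<delta>[rule_format]) (auto intro: less_imp_le)
    also have "(\<Sum>i<n. \<bar>f (r i) - f (l i)\<bar>) = (\<Sum>xK\<in>Q. \<bar>?inc xK\<bar>)"
      using sum.reindex_bij_betw[OF h, of "\<lambda>xK. \<bar>?inc xK\<bar>"]
      unfolding l_def r_def n_def by (simp add: case_prod_beta' lessThan_atLeast0)
    finally show ?thesis .
  qed
  finally have "f b - f a \<le> e * (1 + (b - a))" by (simp add: algebra_simps)
  also have "\<dots> = e0" using \<open>a \<le> b\<close> unfolding e_def by simp
  finally show "f b \<le> f a + e0" by simp
qed

subsection \<open>The sharp Poincare inequality and integration by parts\<close>

text \<open>Being square integrable on a set of finite measure, \<open>f''\<close> is integrable,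
  and \<open>f'\<close> is a constant plus its indefinite integral.\<close>

lemma H2_with_continuous:
  assumes "H2_with f f' f''"
  shows "continuous_on {0..1} f" "continuous_on {0..1} f'"
proof -
  have deriv: "(f has_real_derivative f' x) (at x within {0..1})" if "x \<in> {0..1}" for x
    using assms that unfolding H2_with_def by blast
  show "continuous_on {0..1} f"
    by (rule DERIV_continuous_on) (rule deriv)
  have one: "in_L2 (\<lambda>x. 1)" unfolding in_L2_def by (auto intro!: continuous_imp_integrable_real)
  have "in_L2 f''" using assms unfolding H2_with_def by blast
  then have "integrable (lebesgue_on {0..1}) f''"
    using in_L2_mult_integrable[OF _ one] by simp
  then have "continuous_on {0..1} (\<lambda>x. f' 0 + integral\<^sup>L (lebesgue_on {0..x}) f'')"
    by (intro continuous_intros indefinite_integral_continuous_real)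
  moreover have "f' 0 + integral\<^sup>L (lebesgue_on {0..x}) f'' = f' x" if "x \<in> {0..1}" for x
    using assms that unfolding H2_with_def by metis
  ultimately show "continuous_on {0..1} f'"
    by (rule continuous_on_eq)
qed

text \<open>The square \<open>(f' - pi * f * cot (pi * x))^2\<close> differs from \<open>f'^2 - pi^2 * f^2\<close> by the derivative of
  \<open>pi * f^2 * cot (pi * x)\<close>. The latter is continuous up to the end points, where the junk value
  \<open>cot = 0\<close> agrees with the limit of the product.\<close>

lemma poincare_wirtinger:
  fixes f f' :: "real \<Rightarrow> real"
  assumes deriv: "\<And>x. x \<in> {0..1} \<Longrightarrow> (f has_real_derivative f' x) (at x within {0..1})"
    and cont: "continuous_on {0..1} f'" and f0: "f 0 = 0" and f1: "f 1 = 0"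
  shows "pi^2 * (L2norm f)^2 \<le> (L2norm f')^2"
proof -
  have contf: "continuous_on {0..1} f" by (rule DERIV_continuous_on) (rule deriv)
  define g where "g x = (f' x)^2 - pi^2 * (f x)^2" for x
  have contg: "continuous_on {0..1} g"
    unfolding g_def by (intro continuous_intros cont contf)
  define G where "G x = integral {0..x} g - pi * (f x)^2 * cot (pi * x)" for x
  have sin_pos: "sin (pi * x) > 0" if "0 < x" "x < 1" for x
    using that by (intro sin_gt_zero) auto
  have cont_cot: "((\<lambda>x. (f x)^2 * cot (pi * x)) \<longlongrightarrow> (f e)^2 * cot (pi * e)) (at e within {0..1})"
    if e: "e = 0 \<or> e = 1" for e
  proof -
    have fe: "f e = 0" using e f0 f1 by auto
    have sin_e: "sin (pi * e) = 0" and cos_e: "cos (pi * e) \<noteq> 0" using e by auto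
    have e01: "e \<in> {0..1}" using e by auto
    have "((\<lambda>x. (f x - f e) / (x - e)) \<longlongrightarrow> f' e) (at e within {0..1})"
      using deriv[OF e01] by (simp add: has_field_derivative_iff)
    moreover have "((\<lambda>x. sin (pi * x)) has_real_derivative pi * cos (pi * e)) (at e within {0..1})"
      by (auto intro!: derivative_eq_intros)
    then have "((\<lambda>x. (sin (pi * x) - sin (pi * e)) / (x - e)) \<longlongrightarrow> pi * cos (pi * e)) (at e within {0..1})"
      by (simp add: has_field_derivative_iff)
    moreover have "(f \<longlongrightarrow> f e) (at e within {0..1})"
      using contf e01 unfolding continuous_on_def by auto
    \<comment> \<open>At an end point \<open>f\<close> and the sine both vanish. Dividing each by
      \<open>x - e\<close> makes their quotient converge, and the spare factor \<open>f x\<close>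
      sends the product to zero.\<close>
    ultimately have "((\<lambda>x. f x * ((f x - f e) / (x - e)) / ((sin (pi * x) - sin (pi * e)) / (x - e)) * cos (pi * x))
        \<longlongrightarrow> f e * f' e / (pi * cos (pi * e)) * cos (pi * e)) (at e within {0..1})"
      using cos_e by (intro tendsto_intros) auto
    moreover have "\<forall>\<^sub>F x in at e within {0..1}.
       f x * ((f x - f e) / (x - e)) / ((sin (pi * x) - sin (pi * e)) / (x - e)) * cos (pi * x) = (f x)^2 * cot (pi * x)"
      unfolding eventually_at_filter
      by (intro always_eventually allI impI) (simp add: fe sin_e cot_def power2_eq_square)
    ultimately have "((\<lambda>x. (f x)^2 * cot (pi * x)) \<longlongrightarrow> 0) (at e within {0..1})"
      by (simp add: fe filterlim_cong)
    then show ?thesis by (simp add: fe)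
  qed
  have contG: "continuous_on {0..1} G"
  proof -
    have "continuous_on {0..1} (\<lambda>x. (f x)^2 * cot (pi * x))"
      unfolding continuous_on_def
    proof
      fix x :: real assume x: "x \<in> {0..1}"
      show "((\<lambda>x. (f x)^2 * cot (pi * x)) \<longlongrightarrow> (f x)^2 * cot (pi * x)) (at x within {0..1})"
      proof (cases "x = 0 \<or> x = 1")
        case False
        then have "sin (pi * x) \<noteq> 0" using sin_pos[of x] x by auto
        moreover have "(f \<longlongrightarrow> f x) (at x within {0..1})"
          using contf x unfolding continuous_on_def by auto
        ultimately show ?thesis unfolding cot_def by (intro tendsto_intros)
      qed (rule cont_cot)
    qed
    then have "continuous_on {0..1} (\<lambda>x. pi * ((f x)^2 * cot (pi * x)))"
      by (rule continuous_on_mult_left)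
    moreover have "continuous_on {0..1} (\<lambda>x. integral {0..x} g)"
      by (intro indefinite_integral_continuous_1 integrable_continuous_real contg)
    ultimately show ?thesis unfolding G_def mult.assoc by (intro continuous_on_diff)
  qed
  \<comment> \<open>On the open interval the derivative of \<open>G\<close> is the perfect square.
    The cotangent terms vanish at both ends, so \<open>G 0 = 0\<close> and \<open>G 1\<close> is the
    integral of \<open>g\<close>.\<close>
  have "G 0 \<le> G 1"
  proof (rule DERIV_nonneg_imp_increasing_open[of 0 1 G])
    fix x :: real assume x: "0 < x" "x < 1"
    have at: "at x within {0..1} = at x" using x by (intro at_within_interior) auto
    have "((\<lambda>x. integral {0..x} g) has_real_derivative g x) (at x)"
      using integral_has_real_derivative[OF contg, of x] x at by auto
    moreover have df: "(f has_real_derivative f' x) (at x)" using deriv[of x] x at by auto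
    moreover have "((\<lambda>x. cot (pi * x)) has_real_derivative - inverse ((sin (pi * x))^2) * pi) (at x)"
      using sin_pos[OF x] by (intro DERIV_chain2[OF DERIV_cot]) (auto intro!: derivative_eq_intros)
    ultimately have "(G has_real_derivative (g x - (pi * (2 * f x * f' x) * cot (pi * x)
        + (- inverse ((sin (pi * x))^2) * pi) * (pi * (f x)^2)))) (at x)"
      unfolding G_def by (auto intro!: derivative_eq_intros)
    moreover have "g x - (pi * (2 * f x * f' x) * cot (pi * x)
        + (- inverse ((sin (pi * x))^2) * pi) * (pi * (f x)^2)) = (f' x - pi * f x * cot (pi * x))^2"
    proof -
      have "inverse ((sin (pi * x))^2) = 1 + (cot (pi * x))^2"
        using sin_pos[OF x] sin_cos_squared_add[of "pi * x"] unfolding cot_def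
        by (simp add: field_simps)
      then show ?thesis unfolding g_def by (simp add: power2_eq_square algebra_simps)
    qed
    ultimately show "\<exists>y. (G has_real_derivative y) (at x) \<and> 0 \<le> y" by auto
  qed (use contG in auto)
  then have "0 \<le> integral {0..1} g" unfolding G_def using f0 f1 by simp
  also have "integral {0..1} g = (L2norm f')^2 - pi^2 * (L2norm f)^2"
  proof -
    have *: "integrable (lebesgue_on {0..1}) (\<lambda>x. (h x)^2)" if "continuous_on {0..1} h" for h :: "real \<Rightarrow> real"
      by (intro continuous_imp_integrable_real continuous_intros that)
    have "integral {0..1} g = integral\<^sup>L (lebesgue_on {0..1}) g"
      by (rule lebesgue_integral_eq_integral[symmetric]) (auto intro!: continuous_imp_integrable_real contg)
    then show ?thesis unfolding g_def L2norm_power2 using *[OF cont] *[OF contf] by simp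
  qed
  finally show ?thesis by simp
qed

text \<open>Fubini's theorem on the triangle \<open>x \<le> s\<close>, integrating \<open>f'' x * f' s\<close> in both orders.\<close>

lemma H2_integration_by_parts:
  assumes H2: "H2_with f f' f''" and f0: "f 0 = 0" and f1: "f 1 = 0"
  shows "integral\<^sup>L (lebesgue_on {0..1}) (\<lambda>x. f x * f'' x) = - ((L2norm f')^2)"
proof -
  let ?M = "lebesgue_on {0..1::real}"
  interpret M: finite_measure ?M by (rule finite_measure_lebesgue_on) simp
  interpret P: pair_sigma_finite ?M ?M ..
  have deriv: "\<And>x. x \<in> {0..1} \<Longrightarrow> (f has_real_derivative f' x) (at x within {0..1})"
    and f'': "in_L2 f''" and f': "\<And>x. x \<in> {0..1} \<Longrightarrow> f' x = f' 0 + integral\<^sup>L (lebesgue_on {0..x}) f''"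
    using H2 unfolding H2_with_def by blast+
  note cont = H2_with_continuous[OF H2]
  have i1: "integrable ?M f'" "integrable ?M f" by (intro continuous_imp_integrable_real cont)+
  have "in_L2 (\<lambda>x. 1)" unfolding in_L2_def by (auto intro!: continuous_imp_integrable_real)
  then have i2: "integrable ?M f''" using in_L2_mult_integrable[OF f'', of "\<lambda>x. 1"] by simp
  have [measurable]: "f' \<in> borel_measurable ?M" "f'' \<in> borel_measurable ?M"
    using i1 i2 by auto
  have id[measurable]: "(\<lambda>x. x) \<in> borel_measurable ?M"
    using id_borel_measurable_lebesgue_on by (simp add: id_def)
  define F where "F = (\<lambda>(x, s). if x \<le> s then f'' x * f' s else 0)"
  have F[measurable]: "F \<in> borel_measurable (?M \<Otimes>\<^sub>M ?M)"
    unfolding F_def by measurable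
  have iF: "integrable (?M \<Otimes>\<^sub>M ?M) F"
  proof (rule P.Fubini_integrable[OF F])
    have "integrable ?M (\<lambda>s. f'' x * f' s)" for x using i1 by auto
    then have a: "integrable ?M (\<lambda>s. F (x, s))" for x
    proof (rule Bochner_Integration.integrable_bound)
      show "(\<lambda>s. F (x, s)) \<in> borel_measurable ?M" unfolding F_def split_conv
        by measurable
    qed (auto simp: F_def)
    then show "AE x in ?M. integrable ?M (\<lambda>s. F (x, s))" by auto
    show "integrable ?M (\<lambda>x. \<integral>s. norm (F (x, s)) \<partial>?M)"
    proof (rule Bochner_Integration.integrable_bound)
      show "integrable ?M (\<lambda>x. norm (f'' x) * (\<integral>s. norm (f' s) \<partial>?M))" using i2 by auto
      show "(\<lambda>x. \<integral>s. norm (F (x, s)) \<partial>?M) \<in> borel_measurable ?M" by measurable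
      have "(\<integral>s. norm (F (x, s)) \<partial>?M) \<le> (\<integral>s. norm (f'' x) * norm (f' s) \<partial>?M)" for x
        using i1 by (intro integral_mono integrable_norm a) (auto simp: F_def abs_mult)
      then show "AE x in ?M. norm (\<integral>s. norm (F (x, s)) \<partial>?M) \<le> norm (norm (f'' x) * (\<integral>s. norm (f' s) \<partial>?M))"
        by (auto simp: abs_mult)
    qed
  qed
  have restrict: "(\<integral>x. (if x \<in> {c..d} then h x else 0) \<partial>?M) = integral\<^sup>L (lebesgue_on {c..d}) h"
    if "0 \<le> c" "d \<le> 1" for c d and h :: "real \<Rightarrow> real"
  proof -
    have "(\<integral>x. (if x \<in> {c..d} then h x else 0) \<partial>?M) = (\<integral>x. indicator {0..1} x *\<^sub>R (if x \<in> {c..d} then h x else 0) \<partial>lebesgue)"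
      by (intro integral_restrict_space) auto
    also have "\<dots> = (\<integral>x. indicator {c..d} x *\<^sub>R h x \<partial>lebesgue)"
      using that by (intro Bochner_Integration.integral_cong) (auto split: split_indicator)
    also have "\<dots> = integral\<^sup>L (lebesgue_on {c..d}) h"
      by (intro integral_restrict_space[symmetric]) auto
    finally show ?thesis .
  qed
  \<comment> \<open>With \<open>s\<close> first, the inner integral of \<open>f'\<close> is
    \<open>f 1 - f x = - f x\<close>. With \<open>x\<close> first, the inner integral of
    \<open>f''\<close> is \<open>f' s - f' 0\<close>, and the constant \<open>f' 0\<close> drops out
    because \<open>f'\<close> has integral \<open>f 1 - f 0 = 0\<close>.\<close>
  have "(\<integral>x. (\<integral>s. F (x, s) \<partial>?M) \<partial>?M) = (\<integral>x. - (f x * f'' x) \<partial>?M)"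
  proof (rule Bochner_Integration.integral_cong[OF refl])
    fix x assume "x \<in> space ?M"
    then have x: "0 \<le> x" "x \<le> 1" by auto
    have "(\<integral>s. F (x, s) \<partial>?M) = (\<integral>s. f'' x * (if s \<in> {x..1} then f' s else 0) \<partial>?M)"
      by (intro Bochner_Integration.integral_cong) (auto simp: F_def)
    also have "\<dots> = f'' x * integral\<^sup>L (lebesgue_on {x..1}) f'"
      using restrict[of x 1 f'] x by simp
    also have "integral\<^sup>L (lebesgue_on {x..1}) f' = integral {x..1} f'"
      using x by (intro lebesgue_integral_eq_integral continuous_imp_integrable_real continuous_on_subset[OF cont(2)]) auto
    also have "\<dots> = f 1 - f x"
      using x by (intro integral_unique fundamental_theorem_of_calculus)
        (auto intro!: has_vector_derivative_within_subset[OF deriv[unfolded has_real_derivative_iff_has_vector_derivative]])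
    finally show "(\<integral>s. F (x, s) \<partial>?M) = - (f x * f'' x)" using f1 by simp
  qed
  moreover have "(\<integral>s. (\<integral>x. F (x, s) \<partial>?M) \<partial>?M) = (\<integral>s. (f' s)^2 - f' 0 * f' s \<partial>?M)"
  proof (rule Bochner_Integration.integral_cong[OF refl])
    fix s assume "s \<in> space ?M"
    then have s: "0 \<le> s" "s \<le> 1" by auto
    have "(\<integral>x. F (x, s) \<partial>?M) = (\<integral>x. (if x \<in> {0..s} then f'' x else 0) * f' s \<partial>?M)"
      by (intro Bochner_Integration.integral_cong) (auto simp: F_def)
    also have "\<dots> = integral\<^sup>L (lebesgue_on {0..s}) f'' * f' s"
      using restrict[of 0 s f''] s by simp
    finally show "(\<integral>x. F (x, s) \<partial>?M) = (f' s)^2 - f' 0 * f' s"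
      using f'[of s] s by (simp add: power2_eq_square algebra_simps)
  qed
  moreover have "(\<integral>s. (\<integral>x. F (x, s) \<partial>?M) \<partial>?M) = (\<integral>x. (\<integral>s. F (x, s) \<partial>?M) \<partial>?M)"
    using P.Fubini_integral[of "\<lambda>x s. F (x, s)"] iF by simp
  moreover have "(\<integral>s. (f' s)^2 - f' 0 * f' s \<partial>?M) = (L2norm f')^2 - f' 0 * (\<integral>s. f' s \<partial>?M)"
  proof -
    have "integrable ?M (\<lambda>s. (f' s)^2)" by (intro continuous_imp_integrable_real continuous_intros cont)
    then show ?thesis unfolding L2norm_power2 using i1 by simp
  qed
  moreover have "(\<integral>s. f' s \<partial>?M) = 0"
  proof -
    have "(\<integral>s. f' s \<partial>?M) = integral {0..1} f'" using i1 by (intro lebesgue_integral_eq_integral) auto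
    also have "\<dots> = f 1 - f 0"
      by (intro integral_unique fundamental_theorem_of_calculus)
        (auto intro!: deriv[unfolded has_real_derivative_iff_has_vector_derivative])
    finally show ?thesis using f0 f1 by simp
  qed
  ultimately show ?thesis by simp
qed

subsection \<open>Comparison and energy estimates\<close>

text \<open>Provides exceptional sets in the form needed by the gauge argument for absolutely
  continuous functions.\<close>

lemma AE_lebesgue_on_obtain_negligible:
  assumes "AE t in lebesgue_on S. P t" "S \<in> sets lebesgue"
  obtains N where "negligible N" "\<And>t. t \<in> S \<Longrightarrow> t \<notin> N \<Longrightarrow> P t"
proof -
  obtain N where N: "N \<in> null_sets (lebesgue_on S)" "{t \<in> space (lebesgue_on S). \<not> P t} \<subseteq> N"
    using assms(1) unfolding eventually_ae_filter by blast
  have "negligible N"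
    using N(1) assms(2) by (simp add: null_sets_restrict_space negligible_iff_null_sets)
  then show thesis using N(2) by (intro that[of N]) auto
qed

text \<open>\<open>real_of_ereal\<close> sends infinite values to 0, so the essential supremum must
  be shown finite: it lies between 0 and the given bound. The lower estimate rests on the half-line
  having nonzero measure.\<close>

lemma ess_norm_AE:
  assumes "in_Linf g"
  shows "AE t in lebesgue_on {0..}. \<bar>g t\<bar> \<le> ess_norm g" "ess_norm g \<ge> 0"
proof -
  let ?M = "lebesgue_on {0::real..}"
  let ?E = "esssup ?M (\<lambda>t. ereal \<bar>g t\<bar>)"
  obtain B where B: "AE t in ?M. \<bar>g t\<bar> \<le> B" and meas: "g \<in> borel_measurable ?M"
    using assms unfolding in_Linf_def by blast
  have m: "(\<lambda>t. ereal \<bar>g t\<bar>) \<in> borel_measurable ?M"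
    using meas by measurable
  have "?E \<le> ereal B"
    using B by (intro esssup_I m) auto
  moreover have "0 \<le> ?E"
  proof -
    have "emeasure ?M (space ?M) \<noteq> 0"
    proof -
      have "emeasure lebesgue {0::real..1} \<le> emeasure lebesgue {0::real..}"
        by (intro emeasure_mono) auto
      then show ?thesis by (auto simp: emeasure_restrict_space)
    qed
    then have "esssup ?M (\<lambda>t. 0::ereal) = 0" by (rule esssup_const)
    moreover have "esssup ?M (\<lambda>t. 0::ereal) \<le> ?E" by (rule esssup_mono) auto
    ultimately show ?thesis by simp
  qed
  ultimately have E: "?E = ereal (ess_norm g)" "ess_norm g \<ge> 0"
    unfolding ess_norm_def by (cases ?E; auto)+
  show "ess_norm g \<ge> 0" by (rule E)
  have "AE t in ?M. ereal \<bar>g t\<bar> \<le> ?E" by (rule esssup_AE)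
  then show "AE t in ?M. \<bar>g t\<bar> \<le> ess_norm g" unfolding E by simp
qed

text \<open>An excess at \<open>t\<close> would persist on an interval to its right, which stays in
  the half-line even for \<open>t = 0\<close> and is not negligible. This bounds the continuous
  parameters at every time, whereas \<open>d\<close> is bounded almost everywhere only.\<close>

lemma ess_norm_continuous:
  assumes "in_Linf g" and cont: "continuous_on {0..} g" and "t \<ge> 0"
  shows "\<bar>g t\<bar> \<le> ess_norm g"
proof (rule ccontr)
  assume "\<not> ?thesis"
  then have gt: "ess_norm g < \<bar>g t\<bar>" by simp
  have "((\<lambda>s. \<bar>g s\<bar>) \<longlongrightarrow> \<bar>g t\<bar>) (at t within {0..})"
    using cont \<open>t \<ge> 0\<close> unfolding continuous_on_def by (intro tendsto_intros) auto
  then have "\<forall>\<^sub>F s in at t within {0..}. ess_norm g < \<bar>g s\<bar>"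
    using gt by (rule order_tendstoD)
  then obtain \<delta> where "\<delta> > 0" and \<delta>: "\<And>s. s \<ge> 0 \<Longrightarrow> s \<noteq> t \<Longrightarrow> dist s t < \<delta> \<Longrightarrow> ess_norm g < \<bar>g s\<bar>"
    unfolding eventually_at by (auto simp: Ball_def)
  obtain N where N: "negligible N" "\<And>s. s \<in> {0..} \<Longrightarrow> s \<notin> N \<Longrightarrow> \<bar>g s\<bar> \<le> ess_norm g"
    using AE_lebesgue_on_obtain_negligible[OF ess_norm_AE(1)[OF assms(1)]] by auto
  have "{t<..<t + \<delta>} \<subseteq> N"
  proof
    fix s assume "s \<in> {t<..<t + \<delta>}"
    then have "ess_norm g < \<bar>g s\<bar>" using \<open>t \<ge> 0\<close> by (intro \<delta>) (auto simp: dist_real_def)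
    then show "s \<in> N" using N(2)[of s] \<open>s \<in> {t<..<t + \<delta>}\<close> \<open>t \<ge> 0\<close> by auto
  qed
  then have "negligible {t<..<t + \<delta>}" using N(1) negligible_subset by blast
  then show False using \<open>\<delta> > 0\<close> open_not_negligible[of "{t<..<t + \<delta>}"] by auto
qed

lemma abs_cont_on_C1_bound:
  assumes deriv: "\<And>t. s \<le> t \<Longrightarrow> t \<le> r \<Longrightarrow> (f has_real_derivative f' t) (at t)"
    and bound: "\<And>t. s \<le> t \<Longrightarrow> t \<le> r \<Longrightarrow> \<bar>f' t\<bar> \<le> C"
  shows "abs_cont_on s r f"
proof (rule abs_cont_on_lipschitz)
  fix u v assume uv: "s \<le> u" "u \<le> v" "v \<le> r"
  have "norm (f v - f u) \<le> C * norm (v - u)"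
  proof (rule field_differentiable_bound)
    show "convex {s..r}" by simp
    show "(f has_field_derivative f' z) (at z within {s..r})" if "z \<in> {s..r}" for z
      using that deriv by (auto intro: has_field_derivative_at_within)
  qed (use uv bound in auto)
  then show "\<bar>f v - f u\<bar> \<le> C * (v - u)" using uv by simp
qed

lemma abs_cont_on_exp: "abs_cont_on s r (\<lambda>t. exp (k * t :: real))"
proof (rule abs_cont_on_C1_bound)
  show "((\<lambda>t. exp (k * t)) has_real_derivative k * exp (k * t)) (at t)" for t
    by (auto intro!: derivative_eq_intros)
  fix t assume t: "s \<le> t" "t \<le> r"
  have "\<bar>k * t\<bar> \<le> \<bar>k\<bar> * (\<bar>s\<bar> + \<bar>r\<bar>)"
    unfolding abs_mult using t by (intro mult_left_mono) auto
  then have "k * t \<le> \<bar>k\<bar> * (\<bar>s\<bar> + \<bar>r\<bar>)" by (rule abs_le_D1)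
  then show "\<bar>k * exp (k * t)\<bar> \<le> \<bar>k\<bar> * exp (\<bar>k\<bar> * (\<bar>s\<bar> + \<bar>r\<bar>))"
    unfolding abs_mult by (intro mult_left_mono) auto
qed

text \<open>The integrating factor makes \<open>exp (k * s) * (f s - C / k)\<close> nonincreasing.
  Absolute continuity is asked for only to the right of \<open>T\<close>, since the squared norm of
  \<open>w\<close> is known to be merely continuous at time 0; letting the left end tend to
  \<open>T\<close> closes the gap.\<close>

lemma abs_cont_gronwall:
  fixes f :: "real \<Rightarrow> real"
  assumes "k > 0" and cont: "continuous_on {T..} f"
    and ac: "\<And>s r. T < s \<Longrightarrow> s \<le> r \<Longrightarrow> abs_cont_on s r f"
    and N: "negligible N"
    and deriv: "\<And>t. T < t \<Longrightarrow> t \<notin> N \<Longrightarrow> \<exists>D. (f has_real_derivative D) (at t) \<and> D \<le> - k * f t + C"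
    and "t \<ge> T"
  shows "f t \<le> exp (- k * (t - T)) * (f T - C / k) + C / k"
proof -
  define F where "F s = exp (k * s) * (f s - C / k)" for s
  have le: "F t \<le> F s" if s: "T < s" "s \<le> t" for s
  proof (rule abs_cont_on_nonincreasing[OF _ \<open>s \<le> t\<close> N])
    have cf: "continuous_on {s..t} f" using that by (intro continuous_on_subset[OF cont]) auto
    have "abs_cont_on s t (\<lambda>u. - (C / k))" by (rule abs_cont_on_lipschitz[where C = 0]) auto
    from abs_cont_on_add[OF ac[OF that] this] have "abs_cont_on s t (\<lambda>u. f u - C / k)" by simp
    then show "abs_cont_on s t F"
      unfolding F_def by (intro abs_cont_on_mult abs_cont_on_exp continuous_intros cf)
    fix u assume u: "u \<in> {s..t} - N"
    then obtain D where D: "(f has_real_derivative D) (at u)" "D \<le> - k * f u + C"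
      using deriv[of u] s by auto
    have "(F has_real_derivative exp (k * u) * (D + k * f u - C)) (at u)"
      unfolding F_def using D(1) \<open>k > 0\<close> by (auto intro!: derivative_eq_intros simp: algebra_simps)
    moreover have "exp (k * u) * (D + k * f u - C) \<le> 0"
      using D(2) by (intro mult_nonneg_nonpos) auto
    ultimately show "\<exists>D\<le>0. (F has_real_derivative D) (at u)" by blast
  qed
  have "F t \<le> F T"
  proof (cases "t = T")
    case False
    then have "T < t" using \<open>t \<ge> T\<close> by simp
    have "continuous_on {T..} F" unfolding F_def by (intro continuous_intros cont)
    then have "(F \<longlongrightarrow> F T) (at T within {T..})" unfolding continuous_on_def by auto
    then have "(F \<longlongrightarrow> F T) (at_right T)" by (rule tendsto_within_subset) auto
    moreover have "\<forall>\<^sub>F s in at_right T. F t \<le> F s"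
      using eventually_at_right_real[OF \<open>T < t\<close>] by eventually_elim (auto intro: le)
    ultimately show ?thesis by (rule tendsto_lowerbound) simp
  qed simp
  then have "f t - C / k \<le> exp (k * T) * (f T - C / k) / exp (k * t)"
    unfolding F_def by (simp add: pos_le_divide_eq mult.commute)
  also have "\<dots> = exp (- k * (t - T)) * (f T - C / k)"
    by (simp add: exp_diff diff_divide_distrib algebra_simps)
  finally show ?thesis by simp
qed

text \<open>Write \<open>g = p * f'' + r\<close>. Integration by parts and the Poincare inequality
  handle the first term, Cauchy-Schwarz the second; the pointwise bound \<open>m\<close> on
  \<open>r\<close> is also a bound on its norm because the interval has length 1.\<close>

lemma heat_energy:
  assumes H2: "H2_with f f' f''" and bc: "f 0 = 0" "f 1 = 0"
    and f: "in_L2 f" and g: "in_L2 g" and "p \<ge> 0" and m0: "m \<ge> 0"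
    and src: "AE x in lebesgue_on {0..1}. \<bar>g x - p * f'' x\<bar> \<le> m"
  shows "integral\<^sup>L (lebesgue_on {0..1}) (\<lambda>x. f x * g x) \<le> - (p * pi^2) * (L2norm f)^2 + m * L2norm f"
proof -
  let ?M = "lebesgue_on {0..1::real}"
  have f'': "in_L2 f''" using H2 unfolding H2_with_def by blast
  define r where "r x = g x - p * f'' x" for x
  have r: "in_L2 r" unfolding r_def by (intro in_L2_diff g in_L2_cmult f'')
  have one: "integrable ?M (\<lambda>x. m^2)" by (intro continuous_imp_integrable_real) auto
  have "(L2norm r)^2 \<le> integral\<^sup>L ?M (\<lambda>x. m^2)"
    unfolding L2norm_power2
  proof (rule integral_mono_AE)
    show "AE x in ?M. (r x)^2 \<le> m^2"
      using src by eventually_elim (metis r_def abs_ge_zero power2_abs power_mono)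
  qed (use r one in \<open>auto simp: in_L2_def\<close>)
  also have "\<dots> = m^2" by (simp add: measure_restrict_space)
  finally have "L2norm r \<le> m" using m0 by (rule power2_le_imp_le)
  then have "L2norm f * L2norm r \<le> m * L2norm f"
    unfolding mult.commute[of m] by (intro mult_left_mono L2norm_nonneg)
  moreover have "integral\<^sup>L ?M (\<lambda>x. f x * r x) \<le> L2norm f * L2norm r"
    using L2_Cauchy_Schwarz[OF f r] by simp
  moreover have "integral\<^sup>L ?M (\<lambda>x. f x * g x) = p * integral\<^sup>L ?M (\<lambda>x. f x * f'' x) + integral\<^sup>L ?M (\<lambda>x. f x * r x)"
  proof -
    have "(\<lambda>x. f x * g x) = (\<lambda>x. p * (f x * f'' x) + f x * r x)"
      unfolding r_def by (auto simp: algebra_simps)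
    then show ?thesis
      using in_L2_mult_integrable[OF f f''] in_L2_mult_integrable[OF f r] by simp
  qed
  moreover have "pi^2 * (L2norm f)^2 \<le> (L2norm f')^2"
    using H2 unfolding H2_with_def
    by (intro poincare_wirtinger bc H2_with_continuous(2)[OF H2]) blast
  then have "p * (pi^2 * (L2norm f)^2) \<le> p * (L2norm f')^2" using \<open>p \<ge> 0\<close> by (rule mult_left_mono)
  ultimately show ?thesis
    unfolding H2_integration_by_parts[OF H2 bc] by (simp add: mult.assoc)
qed

subsection \<open>Young-type inequalities\<close>

lemma weighted_young:
  fixes q u v :: real
  assumes "q > 0"
  shows "2 * u * v \<le> q * u^2 + v^2 / q"
proof -
  have "0 \<le> (q * u - v)^2 / q" using assms by simp
  also have "\<dots> = q * u^2 - 2 * u * v + v^2 / q"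
    using assms by (simp add: power2_eq_square field_simps)
  finally show ?thesis by simp
qed

text \<open>Both \<open>B\<close> and \<open>B / a\<close> are at least 1, so
  \<open>B * (B / a)^6\<close> is above every lower power. It is applied with \<open>j = 1\<close>
  and \<open>j = 3\<close>, the powers of the Young weight.\<close>

lemma gain_ge_power:
  fixes a B :: real
  assumes "0 < a" "a \<le> 1" "1 \<le> b" "b \<le> B" "j \<le> 6"
  shows "(b / a)^j \<le> B^7 / a^6"
proof -
  have "(b / a)^j \<le> (B / a)^j" using assms by (intro power_mono divide_right_mono) auto
  also have "\<dots> \<le> (B / a)^6" using assms by (intro power_increasing) (auto simp: field_simps)
  also have "\<dots> \<le> B * (B / a)^6" using assms by (intro mult_le_cancel_right1[THEN iffD2]) auto
  also have "\<dots> = B^7 / a^6" by (simp add: power_divide power_numeral_reduce)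
  finally show ?thesis .
qed

text \<open>Here \<open>N\<close> stands for the norm of \<open>w\<close>, \<open>n\<close> for the
  derivative of its square and \<open>B\<close> for \<open>b + exp z\<close>. Of the dissipation
  \<open>2 * q * N^2\<close>, one \<open>q\<close> pays for the coupling through \<open>t1\<close>,
  \<open>q / 2\<close> for that through \<open>t2\<close>, and the last \<open>q / 2\<close> covers
  \<open>\<kappa>\<close>. The couplings leave at most two copies of
  \<open>\<Theta>^2 * y^2 / q\<close>, one absorbed by \<open>y^4\<close>, the other by
  \<open>y^8\<close>.\<close>

lemma total_energy_decay:
  fixes y n N p q c a b B \<Theta> D t1 t2 l dd :: real
  assumes p: "p > 0" and q: "q = p * pi^2" and c: "c \<ge> 1" and ab: "0 < a" "a \<le> 1" "1 \<le> b" "b \<le> B"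
    and t: "t1^2 + t2^2 \<le> \<Theta>^2" and l: "\<bar>l\<bar> \<le> N" and dd: "\<bar>dd\<bar> \<le> D" and \<kappa>: "\<kappa> \<le> q / 2" "\<kappa> \<le> 2 * c"
    and n: "n \<le> - 2 * q * N^2 + 2 * (\<bar>t1\<bar> * \<bar>y\<bar> * N)"
  shows "n + 2 * y * (- c * (1 + B^7 / (4 * a^6)) * (y^7 + y^3 + y) + t2 * l + dd)
    \<le> - \<kappa> * (N^2 + y^2) + (2 * a * (D^2 + \<Theta>^8 + 2 / p^2) / b + \<Theta>^4 / (2 * p^2 * pi^4))"
proof -
  define g where "g = B^7 / a^6"
  have g4: "B^7 / (4 * a^6) = g / 4" unfolding g_def by simp
  have y_poly: "y * (y^7 + y^3 + y) = y^8 + y^4 + y^2"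
    by (simp add: distrib_left power_numeral_reduce)
  have q0: "q > 0" using p q by simp
  have pi1: "pi \<ge> 1" using pi_ge_two by linarith
  \<comment> \<open>The lower bound \<open>b\<close> replaces the current gain, so that the factor
    \<open>2 / r = 2 * a / b\<close> of the residues is constant in time.\<close>
  define r where "r = b / a"
  have r: "r \<ge> 1" using ab unfolding r_def by (simp add: field_simps)
  have g1: "r \<le> g" and g3: "r^3 \<le> g"
    using gain_ge_power[OF ab, of 1] gain_ge_power[OF ab, of 3] unfolding g_def r_def by auto
  have s1: "2 * (\<bar>t1\<bar> * \<bar>y\<bar> * N) \<le> q * N^2 + t1^2 * y^2 / q"
    using weighted_young[OF q0, of N "\<bar>t1\<bar> * \<bar>y\<bar>"] by (simp add: power_mult_distrib mult_ac)
  have "y * (t2 * l) \<le> \<bar>y * (t2 * l)\<bar>" by simp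
  also have "\<dots> \<le> \<bar>t2\<bar> * \<bar>y\<bar> * N"
    using mult_left_mono[OF l, of "\<bar>t2\<bar> * \<bar>y\<bar>"] by (simp add: abs_mult mult_ac)
  finally have "2 * (y * (t2 * l)) \<le> 2 * N * (\<bar>t2\<bar> * \<bar>y\<bar>)" by (simp add: mult_ac)
  also have "\<dots> \<le> q / 2 * N^2 + 2 * (t2^2 * y^2 / q)"
    using weighted_young[of "q / 2" N "\<bar>t2\<bar> * \<bar>y\<bar>"] q0 by (simp add: power_mult_distrib)
  finally have s2: "2 * (y * (t2 * l)) \<le> q / 2 * N^2 + 2 * (t2^2 * y^2 / q)" .
  have s12: "t1^2 * y^2 / q + 2 * (t2^2 * y^2 / q) \<le> 2 * (\<Theta>^2 * y^2 / q)"
  proof -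
    have "t1^2 + 2 * t2^2 \<le> 2 * \<Theta>^2" using t zero_le_power2[of t1] by linarith
    then have "(t1^2 + 2 * t2^2) * (y^2 / q) \<le> 2 * \<Theta>^2 * (y^2 / q)"
      using q0 by (intro mult_right_mono) auto
    then show ?thesis by (simp add: algebra_simps add_divide_distrib)
  qed
  have s4: "\<Theta>^2 * y^2 / q \<le> \<Theta>^4 / (2 * q^2) + y^4 / 2"
    using weighted_young[of "1/2" "y^2" "\<Theta>^2 / (2 * q)"] q0 by (simp add: power_divide power_mult_distrib field_simps)
  \<comment> \<open>Two Young inequalities with weights dictated by the claimed residues:
    \<open>4 / r\<close> produces \<open>4 / (r * p^2)\<close>, then \<open>2 / r\<close> splits the
    remaining product of \<open>\<Theta>^4\<close> and \<open>y^4\<close> into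
    \<open>\<Theta>^8\<close> and \<open>y^8\<close>. The surplus divisor \<open>1024 * pi^8\<close>
    is given away.\<close>
  have s5: "\<Theta>^2 * y^2 / q \<le> 4 / (r * p^2) + 2 / r * \<Theta>^8 + r^3 * y^8 / 2"
  proof -
    have "\<Theta>^2 * y^2 / q = 2 * (1 / p) * (\<Theta>^2 * y^2 / (2 * pi^2))" unfolding q by simp
    also have "\<dots> \<le> 4 / r * (1 / p)^2 + (\<Theta>^2 * y^2 / (2 * pi^2))^2 / (4 / r)"
      using r by (intro weighted_young) auto
    also have "(\<Theta>^2 * y^2 / (2 * pi^2))^2 / (4 / r) = 2 * \<Theta>^4 * (r * y^4 / (32 * pi^4))"
      by (simp add: power_mult_distrib power_divide)
    also have "\<dots> \<le> 2 / r * (\<Theta>^4)^2 + (r * y^4 / (32 * pi^4))^2 / (2 / r)"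
      using r by (intro weighted_young) auto
    also have "(r * y^4 / (32 * pi^4))^2 / (2 / r) = r^3 * y^8 / 2 / (1024 * pi^8)"
      by (simp add: power_mult_distrib power_divide power2_eq_square power3_eq_cube)
    also have "\<dots> \<le> r^3 * y^8 / 2 / 1"
    proof (rule divide_left_mono)
      show "1 \<le> 1024 * pi^8" using one_le_power[OF pi1, of 8] by simp
    qed (use r in auto)
    finally show ?thesis by (simp add: power_divide)
  qed
  have s3: "2 * (y * dd) \<le> 2 / r * D^2 + r * y^2 / 2"
  proof -
    have "y * dd \<le> \<bar>y * dd\<bar>" by simp
    also have "\<dots> \<le> \<bar>y\<bar> * D" using dd by (simp add: abs_mult mult_left_mono)
    finally have "2 * (y * dd) \<le> 2 * D * \<bar>y\<bar>" by (simp add: mult_ac)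
    also have "\<dots> \<le> 2 / r * D^2 + \<bar>y\<bar>^2 / (2 / r)" using r by (intro weighted_young) auto
    finally show ?thesis by (simp add: mult_ac)
  qed
  \<comment> \<open>The summand 1 in \<open>1 + g / 4\<close> absorbs \<open>y^4 / 2\<close> and
    keeps \<open>2 * c * y^2\<close>; the summand \<open>g / 4\<close> absorbs the terms carrying
    \<open>r\<close> and \<open>r^3\<close>.\<close>
  have damp: "y^4 / 2 + r * y^2 / 2 + r^3 * y^8 / 2 \<le> 2 * c * (1 + g / 4) * (y^8 + y^4 + y^2) - 2 * c * y^2"
  proof -
    have "r * y^2 + r^3 * y^8 \<le> g * y^2 + g * y^8"
      using g1 g3 by (intro add_mono mult_right_mono) auto
    moreover have "0 \<le> g * y^4" using g1 r by auto
    moreover have "0 \<le> y^8" "0 \<le> y^4" by auto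
    ultimately have A: "y^4 / 2 + r * y^2 / 2 + r^3 * y^8 / 2 \<le> 2 * (y^8 + y^4) + g / 2 * (y^8 + y^4 + y^2)"
      unfolding distrib_left by linarith
    have "1 * (2 * (y^8 + y^4) + g / 2 * (y^8 + y^4 + y^2)) \<le> c * (2 * (y^8 + y^4) + g / 2 * (y^8 + y^4 + y^2))"
      using c g1 r by (intro mult_right_mono) auto
    then show ?thesis using A by (simp add: algebra_simps)
  qed
  define P where "P = 2 * c * (1 + g / 4) * (y^8 + y^4 + y^2)"
  have e1: "2 * y * (- c * (1 + B^7 / (4 * a^6)) * (y^7 + y^3 + y) + t2 * l + dd)
     = - P + 2 * (y * (t2 * l)) + 2 * (y * dd)"
    unfolding P_def y_poly[symmetric] g4[symmetric]
    by (simp only: algebra_simps mult_minus_left mult_minus_right minus_add_distrib)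
  have e2: "2 * a * (D^2 + \<Theta>^8 + 2 / p^2) / b = 2 / r * D^2 + 2 / r * \<Theta>^8 + 4 / (r * p^2)"
    unfolding r_def using ab by (simp add: field_simps)
  have e3: "\<Theta>^4 / (2 * p^2 * pi^4) = \<Theta>^4 / (2 * q^2)"
    unfolding q by (simp add: power_mult_distrib)
  have e4: "- \<kappa> * (N^2 + y^2) = - (\<kappa> * N^2) - \<kappa> * y^2" by (simp add: algebra_simps)
  have "\<kappa> * N^2 \<le> q / 2 * N^2" "\<kappa> * y^2 \<le> 2 * c * y^2"
    using \<kappa> by (intro mult_right_mono; simp)+
  then show ?thesis
    unfolding e1 e2 e3 e4 using n s1 s2 s12 s3 s4 s5 damp[folded P_def] by linarith
qed

text \<open>In contrast to the total energy, \<open>N^2\<close> is not absorbed but replaced by an a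
  priori bound \<open>S\<close>. The weight is now \<open>B / a\<close> with the current gain, so
  the residue carries the factor \<open>a / B\<close>, which shrinks as the gain grows.\<close>

lemma output_energy_decay:
  fixes y N S q c a b B \<Theta> D t2 l dd :: real
  assumes q0: "q > 0" and c: "c \<ge> 1" and ab: "0 < a" "a \<le> 1" "1 \<le> b" "b \<le> B"
    and t: "\<bar>t2\<bar> \<le> \<Theta>" and l: "\<bar>l\<bar> \<le> N" and dd: "\<bar>dd\<bar> \<le> D" and S: "N^2 \<le> S"
  shows "y * (- c * (1 + B^7 / (4 * a^6)) * (y^7 + y^3 + y) + t2 * l + dd)
    \<le> - c * y^2 + a / B * (D^2 + q / 2 * S + \<Theta>^4 / (4 * q^2))"
proof -
  define g where "g = B^7 / a^6"
  have g4: "B^7 / (4 * a^6) = g / 4" unfolding g_def by simp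
  have y_poly: "y * (y^7 + y^3 + y) = y^8 + y^4 + y^2"
    by (simp add: distrib_left power_numeral_reduce)
  define r where "r = B / a"
  have r: "r \<ge> 1" using ab unfolding r_def by (simp add: field_simps)
  have ab': "0 < a" "a \<le> 1" "1 \<le> B" "B \<le> B" using ab by auto
  have g1: "r \<le> g" and g3: "r^3 \<le> g"
    using gain_ge_power[OF ab', of 1] gain_ge_power[OF ab', of 3] unfolding g_def r_def by auto
  have "\<Theta> \<ge> 0" using t by auto
  have "y * (t2 * l) \<le> \<bar>y\<bar> * (\<bar>t2\<bar> * \<bar>l\<bar>)" using abs_ge_self[of "y * (t2 * l)"] by (simp add: abs_mult)
  also have "\<dots> \<le> \<bar>y\<bar> * (\<Theta> * N)"
    using t l \<open>\<Theta> \<ge> 0\<close> by (intro mult_left_mono mult_mono) auto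
  also have "\<dots> = 2 * N * (\<Theta> * \<bar>y\<bar> / 2)" by simp
  also have "\<dots> \<le> q / (2 * r) * N^2 + (\<Theta> * \<bar>y\<bar> / 2)^2 / (q / (2 * r))"
    using q0 r by (intro weighted_young) auto
  also have "(\<Theta> * \<bar>y\<bar> / 2)^2 / (q / (2 * r)) = 2 * (\<Theta>^2 / (2 * q)) * (r * y^2 / 2)"
    by (simp add: power_mult_distrib power_divide mult_ac)
  also have "\<dots> \<le> 1 / r * (\<Theta>^2 / (2 * q))^2 + (r * y^2 / 2)^2 / (1 / r)"
    using r by (intro weighted_young) auto
  also have "(r * y^2 / 2)^2 / (1 / r) = r^3 * y^4 / 4"
    by (simp add: power_mult_distrib power_divide power2_eq_square power3_eq_cube power4_eq_xxxx)
  also have "1 / r * (\<Theta>^2 / (2 * q))^2 = 1 / r * (\<Theta>^4 / (4 * q^2))"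
    by (simp add: power_divide power_mult_distrib)
  also have "q / (2 * r) * N^2 \<le> q / (2 * r) * S"
    using S q0 r by (intro mult_left_mono) auto
  finally have s2: "y * (t2 * l) \<le> 1 / r * (q / 2 * S) + 1 / r * (\<Theta>^4 / (4 * q^2)) + r^3 * y^4 / 4"
    by (simp add: mult_ac)
  have "y * dd \<le> \<bar>y\<bar> * \<bar>dd\<bar>" using abs_ge_self[of "y * dd"] by (simp add: abs_mult)
  also have "\<dots> \<le> \<bar>y\<bar> * D" using dd by (intro mult_left_mono) auto
  also have "\<dots> = 2 * D * (\<bar>y\<bar> / 2)" by simp
  also have "\<dots> \<le> 1 / r * D^2 + (\<bar>y\<bar> / 2)^2 / (1 / r)" using r by (intro weighted_young) auto
  finally have s3: "y * dd \<le> 1 / r * D^2 + r * y^2 / 4" by (simp add: power_divide mult_ac)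
  have damp: "r * y^2 / 4 + r^3 * y^4 / 4 \<le> c * (1 + g / 4) * (y^8 + y^4 + y^2) - c * y^2"
  proof -
    have "r * y^2 + r^3 * y^4 \<le> g * y^2 + g * y^4"
      using g1 g3 by (intro add_mono mult_right_mono) auto
    moreover have "0 \<le> g * y^8" using g1 r by auto
    moreover have "0 \<le> y^8" "0 \<le> y^4" by auto
    ultimately have A: "r * y^2 / 4 + r^3 * y^4 / 4 \<le> (y^8 + y^4) + g / 4 * (y^8 + y^4 + y^2)"
      unfolding distrib_left by linarith
    have "1 * ((y^8 + y^4) + g / 4 * (y^8 + y^4 + y^2)) \<le> c * ((y^8 + y^4) + g / 4 * (y^8 + y^4 + y^2))"
      using c g1 r by (intro mult_right_mono) auto
    then show ?thesis using A by (simp add: algebra_simps)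
  qed
  have "y * (- c * (1 + B^7 / (4 * a^6)) * (y^7 + y^3 + y) + t2 * l + dd)
     = - (c * (1 + g / 4) * (y^8 + y^4 + y^2)) + y * (t2 * l) + y * dd"
    unfolding y_poly[symmetric] g4[symmetric]
    by (simp only: algebra_simps mult_minus_left mult_minus_right minus_add_distrib)
  moreover have "a / B * (D^2 + q / 2 * S + \<Theta>^4 / (4 * q^2))
     = 1 / r * D^2 + 1 / r * (q / 2 * S) + 1 / r * (\<Theta>^4 / (4 * q^2))"
    unfolding r_def by (simp add: algebra_simps)
  moreover have "- c * y^2 = - (c * y^2)" by simp
  ultimately show ?thesis using s2 s3 damp by linarith
qed

text \<open>For \<open>q < 1/2\<close> the term \<open>\<Theta>^4 / (4 * q^2)\<close> is absorbed by the products of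
  \<open>1 / (4 * q * \<kappa>)\<close> with \<open>\<Theta>^8\<close> and \<open>2 / p^2\<close>.\<close>

lemma disturbance_gain_le:
  fixes p q \<kappa> a b W D \<Theta> :: real
  assumes p: "p > 0" and q: "q = p * pi^2" and \<kappa>: "0 < \<kappa>" "\<kappa> \<le> q / 2" and ab: "0 < a" "1 \<le> b"
    and W: "W \<ge> 0"
  shows "D^2 + q / 2 * (W + 2 * a * (D^2 + \<Theta>^8 + 2 / p^2) / (b * \<kappa>) + \<Theta>^4 / (2 * p^2 * pi^4 * \<kappa>)) + \<Theta>^4 / (4 * q^2)
    \<le> (4 * p * pi^2 * (b * \<kappa> + a * p * pi^2) + 2 * b * \<kappa> * p^2 * pi^4 + b) / (4 * p * pi^2 * b * \<kappa>)
      * (D^2 + \<Theta>^4 + \<Theta>^8 + 2 / p^2 + W)"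
proof -
  define M where "M = D^2 + \<Theta>^4 + \<Theta>^8 + 2 / p^2 + W"
  define k1 where "k1 = a * q / (b * \<kappa>)"
  define k2 where "k2 = 1 / (4 * q * \<kappa>)"
  have q0: "q > 0" using p q by simp
  have nn: "0 \<le> D^2" "0 \<le> \<Theta>^4" "0 \<le> \<Theta>^8" "0 \<le> 2 / p^2" using p by auto
  have k: "k1 \<ge> 0" "k2 \<ge> 0" unfolding k1_def k2_def using ab q0 \<kappa> by auto
  \<comment> \<open>This reveals the origin of the constant: \<open>q / 2\<close> is the coefficient
    of \<open>W\<close> on the left-hand side, while \<open>k1\<close> and \<open>k2\<close> are
    what \<open>q / 2\<close> makes of the two residues of the decay estimate.\<close>
  have Kb: "(4 * p * pi^2 * (b * \<kappa> + a * p * pi^2) + 2 * b * \<kappa> * p^2 * pi^4 + b) / (4 * p * pi^2 * b * \<kappa>)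
     = 1 + k1 + q / 2 + k2"
  proof -
    have "(4 * p * pi^2 * (b * \<kappa> + a * p * pi^2) + 2 * b * \<kappa> * p^2 * pi^4 + b) / (4 * p * pi^2 * b * \<kappa>)
       = (4 * q * (b * \<kappa> + a * q) + 2 * b * \<kappa> * q^2 + b) / (4 * q * b * \<kappa>)"
      unfolding q by (simp add: power_mult_distrib mult.assoc)
    also have "\<dots> = 1 + k1 + q / 2 + k2"
      unfolding k1_def k2_def using q0 ab \<kappa> by (simp add: field_simps power2_eq_square)
    finally show ?thesis .
  qed
  have lhs: "q / 2 * (W + 2 * a * (D^2 + \<Theta>^8 + 2 / p^2) / (b * \<kappa>) + \<Theta>^4 / (2 * p^2 * pi^4 * \<kappa>))
     = q / 2 * W + k1 * (D^2 + \<Theta>^8 + 2 / p^2) + k2 * \<Theta>^4"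
  proof -
    have "q / 2 * (\<Theta>^4 / (2 * p^2 * pi^4 * \<kappa>)) = q / 2 * (\<Theta>^4 / (2 * q^2 * \<kappa>))"
      unfolding q by (simp add: power_mult_distrib mult.assoc)
    also have "\<dots> = k2 * \<Theta>^4"
      unfolding k2_def using q0 by (simp add: power2_eq_square)
    finally have "q / 2 * (\<Theta>^4 / (2 * p^2 * pi^4 * \<kappa>)) = k2 * \<Theta>^4" .
    moreover have "q / 2 * (2 * a * (D^2 + \<Theta>^8 + 2 / p^2) / (b * \<kappa>)) = k1 * (D^2 + \<Theta>^8 + 2 / p^2)"
      unfolding k1_def by simp
    ultimately show ?thesis by (simp only: distrib_left)
  qed
  have key: "\<Theta>^4 / (4 * q^2) \<le> \<Theta>^4 + k2 * (\<Theta>^8 + 2 / p^2)"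
  proof (cases "q \<ge> 1/2")
    case True
    then have "(1/2)^2 \<le> q^2" by (intro power_mono) auto
    then have "\<Theta>^4 / (4 * q^2) \<le> \<Theta>^4 / 1" by (intro divide_left_mono) (auto simp: power2_eq_square)
    moreover have "0 \<le> k2 * (\<Theta>^8 + 2 / p^2)" using k nn by (intro mult_nonneg_nonneg) auto
    ultimately show ?thesis by simp
  next
    case False
    \<comment> \<open>A small \<open>q\<close> forces \<open>p \<le> 1\<close>, hence
      \<open>2 / p^2 \<ge> 1\<close>, which replaces the 1 in
      \<open>\<Theta>^4 \<le> \<Theta>^8 + 1\<close>.\<close>
    have "p * 1 \<le> p * pi^2" using p pi_ge_two by (intro mult_left_mono one_le_power) auto
    then have "p \<le> 1" using False q by simp
    then have "p^2 \<le> 1" using p by (simp add: power_le_one)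
    then have "1 \<le> 2 / p^2" using p by (simp add: field_simps)
    moreover have "\<Theta>^4 \<le> \<Theta>^8 + 1"
    proof -
      have "2 * \<Theta>^4 \<le> 1 + \<Theta>^8" using weighted_young[of 1 1 "\<Theta>^4"] by simp
      then show ?thesis using nn(2) by linarith
    qed
    ultimately have A: "\<Theta>^4 \<le> \<Theta>^8 + 2 / p^2" by linarith
    have "4 * q * \<kappa> \<le> 4 * q * q" using \<kappa> q0 by (intro mult_left_mono) auto
    then have "1 / (4 * q * q) \<le> k2" unfolding k2_def using q0 \<kappa> by (intro divide_left_mono) auto
    then have "1 / (4 * q * q) * \<Theta>^4 \<le> k2 * (\<Theta>^8 + 2 / p^2)"
      using A k nn by (intro mult_mono) auto
    moreover have "1 / (4 * q * q) * \<Theta>^4 = \<Theta>^4 / (4 * q^2)" by (simp add: power2_eq_square mult.assoc)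
    ultimately show ?thesis using nn(2) by linarith
  qed
  have "(1 + k1 + q / 2 + k2) * M = M + k1 * (D^2 + \<Theta>^8 + 2 / p^2) + k1 * (\<Theta>^4 + W) + q / 2 * W
      + q / 2 * (D^2 + \<Theta>^4 + \<Theta>^8 + 2 / p^2) + k2 * \<Theta>^4 + k2 * (\<Theta>^8 + 2 / p^2) + k2 * (D^2 + W)"
    unfolding M_def by (simp add: algebra_simps add_divide_distrib)
  moreover have "0 \<le> k1 * (\<Theta>^4 + W)" "0 \<le> q / 2 * (D^2 + \<Theta>^4 + \<Theta>^8 + 2 / p^2)" "0 \<le> k2 * (D^2 + W)"
    using k nn W q0 by (auto intro!: mult_nonneg_nonneg add_nonneg_nonneg)
  ultimately show ?thesis
    unfolding Kb lhs M_def[symmetric] using key nn W unfolding M_def by linarith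
qed

subsection \<open>The adaptation law\<close>

lemma abs_cont_on_half_square:
  assumes "abs_cont_on s r y" "continuous_on {s..r} y"
  shows "abs_cont_on s r (\<lambda>t. (y t)^2 / 2)"
proof (rule abs_cont_on_dominated[OF abs_cont_on_mult[OF assms assms] abs_cont_on_mult[OF assms assms]])
  fix u v
  show "\<bar>(y v)^2 / 2 - (y u)^2 / 2\<bar> \<le> 1 * (\<bar>y v * y v - y u * y u\<bar> + \<bar>y v * y v - y u * y u\<bar>)"
    unfolding power2_eq_square diff_divide_distrib[symmetric] by simp
qed

lemma has_real_derivative_half_square:
  assumes "(y has_real_derivative v) (at t)"
  shows "((\<lambda>t. (y t)^2 / 2) has_real_derivative y t * v) (at t)"
  using assms by (auto intro!: derivative_eq_intros)

text \<open>Isolates the scalar adaptation. No equation for \<open>y\<close> is assumed: the heat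
  equation, the controller and the disturbance enter only through upper bounds on \<open>y\<close>
  times its derivative off \<open>N\<close>, supplied to the individual lemmas.\<close>

locale adaptive_gain =
  fixes y z :: "real \<Rightarrow> real" and \<Gamma> \<epsilon> :: real and N :: "real set"
  assumes \<Gamma>: "\<Gamma> > 0" and \<epsilon>: "\<epsilon> > 0"
    and y_cont: "continuous_on {0..} y"
    and y_ac: "\<And>s r. 0 \<le> s \<Longrightarrow> s \<le> r \<Longrightarrow> abs_cont_on s r y"
    and N: "negligible N"
    and z_cont: "continuous_on {0..} z"
    and z_deriv: "\<And>t. 0 < t \<Longrightarrow>
      (z has_real_derivative (\<Gamma> * exp (- z t) * max (y t ^ 2 / 2 - \<epsilon>) 0)) (at t)"
begin

lemma half_square_ac: "0 \<le> s \<Longrightarrow> s \<le> r \<Longrightarrow> abs_cont_on s r (\<lambda>t. (y t)^2 / 2)"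
  by (intro abs_cont_on_half_square y_ac continuous_on_subset[OF y_cont]) auto

lemma gain_cont: "0 \<le> s \<Longrightarrow> continuous_on {s..r} (\<lambda>t. exp (z t))"
  by (intro continuous_intros continuous_on_subset[OF z_cont]) auto

lemma gain_deriv:
  assumes "0 < t"
  shows "((\<lambda>t. exp (z t)) has_real_derivative \<Gamma> * max (y t ^ 2 / 2 - \<epsilon>) 0) (at t)"
proof -
  have "((\<lambda>t. exp (z t)) has_real_derivative
      exp (z t) * (\<Gamma> * exp (- z t) * max (y t ^ 2 / 2 - \<epsilon>) 0)) (at t)"
    by (intro DERIV_fun_exp z_deriv assms)
  moreover have "exp (z t) * (\<Gamma> * exp (- z t) * max (y t ^ 2 / 2 - \<epsilon>) 0) = \<Gamma> * max (y t ^ 2 / 2 - \<epsilon>) 0"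
    by (simp add: exp_minus)
  ultimately show ?thesis by simp
qed

lemma gain_mono:
  assumes "0 \<le> s" "s \<le> t"
  shows "exp (z s) \<le> exp (z t)"
proof (rule DERIV_nonneg_imp_increasing_open[of s t "\<lambda>t. exp (z t)"])
  fix x assume "s < x" "x < t"
  then have "((\<lambda>t. exp (z t)) has_real_derivative \<Gamma> * max (y x ^ 2 / 2 - \<epsilon>) 0) (at x)"
    using assms by (intro gain_deriv) auto
  moreover have "0 \<le> \<Gamma> * max (y x ^ 2 / 2 - \<epsilon>) 0" using \<Gamma> by auto
  ultimately show "\<exists>v. ((\<lambda>t. exp (z t)) has_real_derivative v) (at x) \<and> 0 \<le> v" by blast
qed (use assms gain_cont in auto)

text \<open>Once \<open>b + exp z\<close> exceeds \<open>a * C / (2 * c * \<epsilon>)\<close>, the excess of \<open>y^2 / 2\<close> over \<open>\<epsilon>\<close>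
  decays exponentially and the gain can only grow by a controlled amount.\<close>

lemma gain_bound:
  assumes c: "c > 0" and a: "a > 0" and b: "b \<ge> 1" and C: "C \<ge> 0"
    and y_deriv: "\<And>t. 0 < t \<Longrightarrow> t \<notin> N \<Longrightarrow> \<exists>v. (y has_real_derivative v) (at t) \<and>
        y t * v \<le> - c * (y t)^2 + a / (b + exp (z t)) * C"
    and t: "t \<ge> 0"
  shows "exp (z t) \<le> exp (z 0) + a * C / (2 * c * \<epsilon>) + \<Gamma> / (4 * c) * ((y 0)^2 + a * C / c)"
proof -
  define V where "V t = (y t)^2 / 2" for t
  define thr where "thr = a * C / (2 * c * \<epsilon>)"
  have thr0: "thr \<ge> 0" unfolding thr_def using a C c \<epsilon> by simp
  \<comment> \<open>The rate is \<open>2 * c\<close> because \<open>c * y^2 = 2 * c * V\<close>.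
    Start and residue stay free: the estimate is needed from 0 with the crude residue
    \<open>a * C\<close> and from the threshold time with a sharp one.\<close>
  have V_decay: "V r \<le> exp (- (2 * c) * (r - T)) * (V T - R / (2 * c)) + R / (2 * c)"
    if T: "0 \<le> T" "T \<le> r" and R: "\<And>s. T < s \<Longrightarrow> a / (b + exp (z s)) * C \<le> R" for T r R
  proof (rule abs_cont_gronwall[OF _ _ _ N])
    show "continuous_on {T..} V"
      unfolding V_def using T by (intro continuous_intros continuous_on_subset[OF y_cont]) auto
    show "abs_cont_on s r V" if "T < s" "s \<le> r" for s r
      using half_square_ac[of s r] that T unfolding V_def by auto
    fix s assume s: "T < s" "s \<notin> N"
    obtain v where v: "(y has_real_derivative v) (at s)" "y s * v \<le> - c * (y s)^2 + a / (b + exp (z s)) * C"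
      using y_deriv[of s] s T by auto
    have "y s * v \<le> - (2 * c) * V s + R"
      using v(2) R[OF s(1)] unfolding V_def by simp
    then show "\<exists>D. (V has_real_derivative D) (at s) \<and> D \<le> - (2 * c) * V s + R"
      using has_real_derivative_half_square[OF v(1)] unfolding V_def by blast
  qed (use c T in auto)
  have aB: "a / (b + exp (z s)) * C \<le> a * C" for s
  proof -
    have "1 \<le> b + exp (z s)" using b exp_ge_zero[of "z s"] by linarith
    then have "a / (b + exp (z s)) \<le> a / 1" using a by (intro divide_left_mono) auto
    then show ?thesis using C mult_right_mono by fastforce
  qed
  have y_bound: "(y T)^2 \<le> (y 0)^2 + a * C / c" if T: "T \<ge> 0" for T
  proof -
    have "V T \<le> exp (- (2 * c) * (T - 0)) * (V 0 - a * C / (2 * c)) + a * C / (2 * c)"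
      using T by (intro V_decay aB) auto
    also have "exp (- (2 * c) * (T - 0)) * (V 0 - a * C / (2 * c)) \<le> exp (- (2 * c) * (T - 0)) * V 0"
      using a C c by (intro mult_left_mono) auto
    also have "\<dots> \<le> 1 * V 0"
      using T c by (intro mult_right_mono) (auto simp: V_def)
    finally show ?thesis unfolding V_def using c by (simp add: field_simps)
  qed
  show ?thesis
  proof (cases "b + exp (z t) \<le> thr")
    case True
    then have "exp (z t) \<le> thr" using b by simp
    moreover have "0 \<le> \<Gamma> / (4 * c) * ((y 0)^2 + a * C / c)" using \<Gamma> a C c by auto
    ultimately show ?thesis unfolding thr_def[symmetric] using exp_ge_zero[of "z 0"] by linarith
  next
    case False
    \<comment> \<open>Either the threshold is met at the start, or the continuous gain crosses it at
      a time where \<open>exp (z T) = thr - b\<close>. In both cases the gain at \<open>T\<close> is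
      controlled.\<close>
    have "\<exists>T. 0 \<le> T \<and> T \<le> t \<and> thr \<le> b + exp (z T) \<and> exp (z T) \<le> exp (z 0) + thr"
    proof (cases "thr \<le> b + exp (z 0)")
      case True
      then show ?thesis using t thr0 by (intro exI[of _ 0]) auto
    next
      case F: False
      have "\<exists>T. 0 \<le> T \<and> T \<le> t \<and> exp (z T) = thr - b"
        using F False t by (intro IVT' gain_cont) auto
      then obtain T where T: "0 \<le> T" "T \<le> t" "exp (z T) = thr - b" by blast
      then show ?thesis using b exp_ge_zero[of "z 0"] by (intro exI[of _ T]) (auto simp del: exp_ge_zero)
    qed
    then obtain T where T: "0 \<le> T" "T \<le> t" "thr \<le> b + exp (z T)" "exp (z T) \<le> exp (z 0) + thr" by blast
    define e where "e s = exp (- (2 * c) * (s - T))" for s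
    \<comment> \<open>That \<open>H\<close> does not decrease says that the gain grows by at most
      the integral of \<open>\<Gamma> * V T * e s\<close>, which is below
      \<open>\<Gamma> * V T / (2 * c)\<close>.\<close>
    define H where "H s = - exp (z s) - \<Gamma> * V T / (2 * c) * e s" for s
    have small: "max (V s - \<epsilon>) 0 \<le> e s * V T" if s: "T < s" for s
    proof -
      \<comment> \<open>Past the threshold the residue is at most \<open>2 * c * \<epsilon>\<close>,
        which puts the equilibrium of the comparison equation exactly at
        \<open>\<epsilon>\<close>.\<close>
      have "V s \<le> e s * (V T - 2 * c * \<epsilon> / (2 * c)) + 2 * c * \<epsilon> / (2 * c)"
        unfolding e_def
      proof (rule V_decay)
        fix u assume "T < u"
        then have "thr \<le> b + exp (z u)" using gain_mono[of T u] T by linarith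
        moreover have "0 < b + exp (z u)" using b exp_ge_zero[of "z u"] by linarith
        ultimately show "a / (b + exp (z u)) * C \<le> 2 * c * \<epsilon>"
          unfolding thr_def using c \<epsilon> by (simp add: field_simps)
      qed (use T s in auto)
      then have "V s - \<epsilon> \<le> e s * V T - e s * \<epsilon>" using c by (simp add: algebra_simps)
      moreover have "0 \<le> e s * \<epsilon>" "0 \<le> e s * V T" unfolding e_def V_def using \<epsilon> by auto
      ultimately show ?thesis by simp
    qed
    have "H T \<le> H t"
    proof (rule DERIV_nonneg_imp_increasing_open[of T t H])
      show "continuous_on {T..t} H"
        unfolding H_def e_def using T by (intro continuous_intros gain_cont)
      fix s assume s: "T < s" "s < t"
      have "(e has_real_derivative - (2 * c) * e s) (at s)"
        unfolding e_def by (auto intro!: derivative_eq_intros)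
      then have "(H has_real_derivative - (\<Gamma> * max (V s - \<epsilon>) 0) - \<Gamma> * V T / (2 * c) * (- (2 * c) * e s)) (at s)"
        unfolding H_def V_def using s T by (intro derivative_intros gain_deriv DERIV_cmult) auto
      moreover have "\<Gamma> * max (V s - \<epsilon>) 0 \<le> \<Gamma> * (e s * V T)"
        using small[OF s(1)] \<Gamma> by (intro mult_left_mono) auto
      then have "0 \<le> - (\<Gamma> * max (V s - \<epsilon>) 0) - \<Gamma> * V T / (2 * c) * (- (2 * c) * e s)"
        using c by (simp add: mult_ac)
      ultimately show "\<exists>v. (H has_real_derivative v) (at s) \<and> 0 \<le> v" by blast
    qed (use T in auto)
    moreover have "0 \<le> \<Gamma> * V T / (2 * c) * e t" unfolding e_def V_def using \<Gamma> c by auto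
    ultimately have "exp (z t) \<le> exp (z T) + \<Gamma> * V T / (2 * c)"
      unfolding H_def by (simp add: e_def)
    also have "\<Gamma> * V T / (2 * c) = \<Gamma> / (4 * c) * (y T)^2" unfolding V_def by simp
    also have "\<dots> \<le> \<Gamma> / (4 * c) * ((y 0)^2 + a * C / c)"
      using y_bound[OF T(1)] \<Gamma> c by (intro mult_left_mono) auto
    finally show ?thesis using T(4) unfolding thr_def by linarith
  qed
qed

text \<open>A Barbalat argument: since \<open>y^2 / 2\<close> grows at rate at most \<open>R\<close>, a late excursion above
  \<open>\<epsilon> + \<eta>\<close> is preceded by an interval of fixed length on which the gain increases by a fixed amount.\<close>

lemma output_eventually_small:
  assumes R: "R > 0" and \<eta>: "\<eta> > 0"
    and y_deriv: "\<And>t. 0 < t \<Longrightarrow> t \<notin> N \<Longrightarrow> \<exists>v. (y has_real_derivative v) (at t) \<and> y t * v \<le> R"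
    and bounded: "\<And>t. 0 \<le> t \<Longrightarrow> exp (z t) \<le> G"
  shows "\<forall>\<^sub>F t in at_top. (y t)^2 / 2 \<le> \<epsilon> + \<eta>"
proof -
  define V where "V t = (y t)^2 / 2" for t
  \<comment> \<open>At rate at most \<open>R\<close>, a rise of \<open>V\<close> by
    \<open>\<eta> / 2\<close> takes at least time \<open>h\<close>; meanwhile the gain increases by
    at least the \<open>\<delta>\<close> defined below.\<close>
  define h where "h = \<eta> / (2 * R)"
  have h: "h > 0" unfolding h_def using R \<eta> by simp
  define \<delta> where "\<delta> = \<Gamma> * (\<eta> / 2) * h"
  have \<delta>: "\<delta> > 0" unfolding \<delta>_def using \<Gamma> \<eta> h by simp
  define S where "S = Sup ((\<lambda>t. exp (z t)) ` {0..})"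
  have bdd: "bdd_above ((\<lambda>t. exp (z t)) ` {0..})" using bounded by (intro bdd_aboveI2[of _ _ G]) auto
  \<comment> \<open>From \<open>t0\<close> on, the monotone gain is within \<open>\<delta>\<close>
    of its supremum, so no further increase by \<open>\<delta>\<close> is possible.\<close>
  have "\<exists>t0\<ge>0. S - \<delta> < exp (z t0)"
  proof -
    have "S - \<delta> < S" using \<delta> by simp
    then show ?thesis unfolding S_def using less_cSup_iff[OF _ bdd] by auto
  qed
  then obtain t0 where t0: "t0 \<ge> 0" "S - \<delta> < exp (z t0)" by blast
  have "V t \<le> \<epsilon> + \<eta>" if t: "t > t0 + h" for t
  proof (rule ccontr)
    assume "\<not> ?thesis"
    then have big: "V t > \<epsilon> + \<eta>" by simp
    have V_big: "V s \<ge> \<epsilon> + \<eta> / 2" if s: "t - h < s" "s < t" for s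
    proof -
      have "V t - R * t \<le> V s - R * s"
      proof (rule abs_cont_on_nonincreasing[of s t "\<lambda>u. V u - R * u", OF _ _ N])
        have "abs_cont_on s t (\<lambda>u. - (R * u))"
          using R by (intro abs_cont_on_lipschitz[where C = R]) (auto simp: abs_mult right_diff_distrib[symmetric])
        moreover have "abs_cont_on s t V" unfolding V_def using s t0 t h by (intro half_square_ac) auto
        ultimately show "abs_cont_on s t (\<lambda>u. V u - R * u)"
          using abs_cont_on_add by fastforce
        fix u assume u: "u \<in> {s..t} - N"
        then have "0 < u" using s t0 t h by auto
        then obtain v where v: "(y has_real_derivative v) (at u)" "y u * v \<le> R"
          using y_deriv[of u] u by auto
        have "((\<lambda>u. V u - R * u) has_real_derivative y u * v - R * 1) (at u)"
          unfolding V_def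
          by (intro DERIV_diff has_real_derivative_half_square v DERIV_cmult DERIV_ident)
        then show "\<exists>D\<le>0. ((\<lambda>u. V u - R * u) has_real_derivative D) (at u)"
          using v(2) by (intro exI[of _ "y u * v - R * 1"]) auto
      qed (use s in auto)
      then have "V t - V s \<le> R * (t - s)" by (simp add: algebra_simps)
      also have "\<dots> \<le> R * h" using s R by (intro mult_left_mono) auto
      also have "\<dots> = \<eta> / 2" unfolding h_def using R by simp
      finally show ?thesis using big by simp
    qed
    let ?E = "\<lambda>s. exp (z s) - \<Gamma> * (\<eta> / 2) * s"
    have "?E (t - h) \<le> ?E t"
    proof (rule DERIV_nonneg_imp_increasing_open[of "t - h" t ?E])
      show "continuous_on {t - h..t} ?E"
        using t t0 by (intro continuous_intros gain_cont) auto
      fix s assume s: "t - h < s" "s < t"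
      have "(?E has_real_derivative \<Gamma> * max (y s ^ 2 / 2 - \<epsilon>) 0 - \<Gamma> * (\<eta> / 2) * 1) (at s)"
        using s t t0 by (intro DERIV_diff gain_deriv DERIV_cmult DERIV_ident) auto
      moreover have "\<eta> / 2 \<le> max (y s ^ 2 / 2 - \<epsilon>) 0"
        using V_big[OF s] unfolding V_def by (intro max.coboundedI1) linarith
      then have "\<Gamma> * (\<eta> / 2) \<le> \<Gamma> * max (y s ^ 2 / 2 - \<epsilon>) 0"
        using \<Gamma> by (intro mult_left_mono) auto
      ultimately show "\<exists>v. (?E has_real_derivative v) (at s) \<and> 0 \<le> v"
        by (intro exI[of _ "\<Gamma> * max (y s ^ 2 / 2 - \<epsilon>) 0 - \<Gamma> * (\<eta> / 2) * 1"]) auto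
    qed (use h in auto)
    then have "exp (z (t - h)) + \<delta> \<le> exp (z t)" unfolding \<delta>_def right_diff_distrib by linarith
    moreover have "exp (z t0) \<le> exp (z (t - h))" using t t0 by (intro gain_mono) auto
    moreover have "exp (z t) \<le> S" unfolding S_def using t t0 h by (intro cSup_upper bdd) auto
    ultimately show False using t0(2) by linarith
  qed
  then show ?thesis unfolding V_def eventually_at_top_dense by blast
qed

end

subsection \<open>The closed loop\<close>

text \<open>The source enters only through a bound uniform in \<open>x\<close>. On compact intervals
  of positive times the norms of \<open>w\<close> and \<open>wt\<close> are bounded by continuity,
  so Cauchy-Schwarz bounds the derivative of the squared norm; near time 0 nothing is known about
  \<open>wt\<close>.\<close>

lemma heat_L2norm_power2:
  fixes w wt wx wxx :: "real \<Rightarrow> real \<Rightarrow> real"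
  assumes w_C0: "L2_continuous_on {0..} w"
    and wt_deriv: "\<And>t. t > 0 \<Longrightarrow>
          ((\<lambda>s. L2norm (\<lambda>x. (w s x - w t x) / (s - t) - wt t x)) \<longlongrightarrow> 0) (at t)"
    and wt_cont: "L2_continuous_on {0<..} wt"
    and w_H2: "\<And>t. t > 0 \<Longrightarrow> H2_with (w t) (wx t) (wxx t)"
    and bc: "\<And>t. t > 0 \<Longrightarrow> w t 0 = 0 \<and> w t 1 = 0"
    and p: "p > 0" and m: "\<And>t. t > 0 \<Longrightarrow> m t \<ge> 0"
    and src: "\<And>t. t > 0 \<Longrightarrow> AE x in lebesgue_on {0..1}. \<bar>wt t x - p * wxx t x\<bar> \<le> m t"
  shows "continuous_on {0..} (\<lambda>t. (L2norm (w t))^2)"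
    and "\<And>s r. 0 < s \<Longrightarrow> s \<le> r \<Longrightarrow> abs_cont_on s r (\<lambda>t. (L2norm (w t))^2)"
    and "\<And>t. t > 0 \<Longrightarrow> \<exists>D. ((\<lambda>t. (L2norm (w t))^2) has_real_derivative D) (at t) \<and>
          D \<le> - 2 * (p * pi^2) * (L2norm (w t))^2 + 2 * (m t * L2norm (w t))"
proof -
  have w: "in_L2 (w t)" if "t \<ge> 0" for t using w_C0 that unfolding L2_continuous_on_def by auto
  have wt: "in_L2 (wt t)" if "t > 0" for t using wt_cont that unfolding L2_continuous_on_def by auto
  note cw = L2_continuous_on_norm[OF w_C0] and cwt = L2_continuous_on_norm[OF wt_cont]
  show "continuous_on {0..} (\<lambda>t. (L2norm (w t))^2)" by (intro continuous_intros cw)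
  define n' where "n' t = 2 * integral\<^sup>L (lebesgue_on {0..1}) (\<lambda>x. w t x * wt t x)" for t
  have deriv: "((\<lambda>t. (L2norm (w t))^2) has_real_derivative n' t) (at t)" if "t > 0" for t
    unfolding n'_def using that by (intro L2norm_power2_has_derivative w wt wt_deriv) auto
  show "abs_cont_on s r (\<lambda>t. (L2norm (w t))^2)" if sr: "0 < s" "s \<le> r" for s r
  proof -
    have "compact ((\<lambda>t. 2 * (L2norm (w t) * L2norm (wt t))) ` {s..r})"
      using sr by (intro compact_continuous_image continuous_intros continuous_on_subset[OF cw]
        continuous_on_subset[OF cwt]) auto
    then obtain C where C: "\<And>t. t \<in> {s..r} \<Longrightarrow> norm (2 * (L2norm (w t) * L2norm (wt t))) \<le> C"
      by (metis (no_types, lifting) compact_imp_bounded bounded_iff image_eqI)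
    show ?thesis
    proof (rule abs_cont_on_C1_bound)
      fix t assume t: "s \<le> t" "t \<le> r"
      show "((\<lambda>t. (L2norm (w t))^2) has_real_derivative n' t) (at t)" using t sr by (intro deriv) auto
      have "\<bar>n' t\<bar> \<le> 2 * (L2norm (w t) * L2norm (wt t))"
        unfolding n'_def using L2_Cauchy_Schwarz[OF w[of t] wt[of t]] t sr by simp
      then show "\<bar>n' t\<bar> \<le> C" using C[of t] t by auto
    qed
  qed
  show "\<exists>D. ((\<lambda>t. (L2norm (w t))^2) has_real_derivative D) (at t) \<and>
          D \<le> - 2 * (p * pi^2) * (L2norm (w t))^2 + 2 * (m t * L2norm (w t))" if t: "t > 0" for t
  proof -
    have "n' t \<le> 2 * (- (p * pi^2) * (L2norm (w t))^2 + m t * L2norm (w t))"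
      unfolding n'_def using t p bc[OF t]
      by (intro mult_left_mono heat_energy[OF w_H2[OF t]] w wt src m) auto
    then show ?thesis using deriv[OF t] by (intro exI[of _ "n' t"]) (auto simp: algebra_simps)
  qed
qed

theorem theorem3:
  fixes p \<epsilon> \<Gamma> c a b :: real
    and K :: "real \<Rightarrow> real \<Rightarrow> real"
    and L :: "(real \<Rightarrow> real) \<Rightarrow> real"
    and d \<theta>1 \<theta>2 y z u :: "real \<Rightarrow> real"
    and w wt wx wxx :: "real \<Rightarrow> real \<Rightarrow> real"
    and \<kappa> Kbar Bbar D \<Theta> :: real
  assumes p_pos: "p > 0"
    and L_bound: "\<forall>f. H2_H01 f \<longrightarrow> \<bar>L f\<bar> \<le> L2norm f"
    and K_bound: "\<forall>x\<in>{0..1}. \<forall>v. \<bar>K x v\<bar> \<le> \<bar>v\<bar>"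
    and eps_pos: "\<epsilon> > 0" and Gamma_pos: "\<Gamma> > 0" and c_ge: "c \<ge> 1"
    and b_ge: "b \<ge> 1" and a_le: "1 \<ge> a" and a_pos: "a > 0"
    and d_Linf: "in_Linf d"
    and theta_cont: "continuous_on {0..} \<theta>1" "continuous_on {0..} \<theta>2"
    and theta_Linf: "in_Linf \<theta>1" "in_Linf \<theta>2"
    \<comment> \<open>w \<in> C^0(R_+; L^2(0,1))\<close>
    and w_C0: "L2_continuous_on {0..} w"
    \<comment> \<open>w \<in> C^1((0,\<infinity>); L^2(0,1)), with derivative wt\<close>
    and wt_deriv: "\<forall>t>0. in_L2 (wt t) \<and>
          ((\<lambda>s. L2norm (\<lambda>x. (w s x - w t x) / (s - t) - wt t x)) \<longlongrightarrow> 0) (at t)"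
    and wt_cont: "L2_continuous_on {0<..} wt"
    \<comment> \<open>w \<in> C^0((0,\<infinity>); H^2(0,1) \<inter> H^1_0(0,1)), with x-derivatives wx, wxx\<close>
    and w_H2: "\<forall>t>0. H2_with (w t) (wx t) (wxx t)"
    and w_H2_cont: "L2_continuous_on {0<..} w" "L2_continuous_on {0<..} wx"
                   "L2_continuous_on {0<..} wxx"
    \<comment> \<open>z \<in> C^1(R_+)\<close>
    and z_C1: "\<exists>z'. continuous_on {0..} z' \<and>
          (\<forall>t\<ge>0. (z has_real_derivative z' t) (at t within {0..}))"
    \<comment> \<open>y continuous on R_+, absolutely continuous on compact intervals\<close>
    and y_cont: "continuous_on {0..} y"
    and y_ac: "\<forall>s r. 0 \<le> s \<longrightarrow> s \<le> r \<longrightarrow> abs_cont_on s r y"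
    \<comment> \<open>the PDE and boundary conditions, for all t > 0\<close>
    and pde: "\<forall>t>0. AE x in lebesgue_on {0..1}. wt t x = p * wxx t x + \<theta>1 t * K x (y t)"
    and bc: "\<forall>t>0. w t 0 = 0 \<and> w t 1 = 0"
    \<comment> \<open>the ODE for y, a.e. t > 0\<close>
    and ode_y: "AE t in lebesgue_on {0<..}.
          (y has_real_derivative (u t + \<theta>2 t * L (w t) + d t)) (at t)"
    \<comment> \<open>the controller\<close>
    and u_def: "\<forall>t>0. u t = - c * (1 + (b + exp (z t))^7 / (4 * a^6)) * (y t^7 + y t^3 + y t)"
    and ode_z: "\<forall>t>0. (z has_real_derivative
          (\<Gamma> * exp (- z t) * max (y t ^ 2 / 2 - \<epsilon>) 0)) (at t)"
    and D_def: "D = ess_norm d"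
    and Theta_def: "\<Theta> = ess_norm (\<lambda>t. sqrt ((\<theta>1 t)^2 + (\<theta>2 t)^2))"
    and kappa_def: "\<kappa> = min (p * pi^2 / 2) (2 * c)"
    and Kbar_def: "Kbar = (4 * p * pi^2 * (b * \<kappa> + a * p * pi^2) + 2 * b * \<kappa> * p^2 * pi^4 + b)
                          / (4 * p * pi^2 * b * \<kappa>)"
    and Bbar_def: "Bbar = (a * Kbar * (\<epsilon> * \<Gamma> + 2 * c) + \<epsilon> * c * \<Gamma>) / (4 * c^2 * \<epsilon>)"
  shows "(\<forall>t\<ge>0. (L2norm (w t))^2 + (y t)^2
            \<le> exp (- \<kappa> * t) * ((L2norm (w 0))^2 + (y 0)^2)
              + 2 * a * (D^2 + \<Theta>^8 + 2 / p^2) / (b * \<kappa>)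
              + \<Theta>^4 / (2 * p^2 * pi^4 * \<kappa>))
       \<and> (\<forall>t\<ge>0. z 0 \<le> z t \<and>
            z t \<le> ln (exp (z 0) + Bbar * (D^2 + \<Theta>^4 + \<Theta>^8 + 2 / p^2
                                           + (L2norm (w 0))^2 + (y 0)^2)))
       \<and> Limsup at_top (\<lambda>t. ereal (L2norm (w t)))
            \<le> ereal (sqrt (2 * \<epsilon>) / (p * pi^2)) * Limsup at_top (\<lambda>t. ereal \<bar>\<theta>1 t\<bar>)
       \<and> Limsup at_top (\<lambda>t. ereal \<bar>y t\<bar>) \<le> ereal (sqrt (2 * \<epsilon>))"
proof -

  \<comment> \<open>Constants and pointwise bounds on the parameters\<close>
  define q where "q = p * pi^2"
  have q0: "q > 0" using p_pos unfolding q_def by simp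
  have \<kappa>: "0 < \<kappa>" "\<kappa> \<le> q / 2" "\<kappa> \<le> 2 * c"
    using q0 c_ge unfolding kappa_def q_def by auto
  define \<theta> where "\<theta> t = sqrt ((\<theta>1 t)^2 + (\<theta>2 t)^2)" for t
  have \<theta>_Linf: "in_Linf \<theta>"
  proof -
    obtain B1 B2 where B: "AE t in lebesgue_on {0..}. \<bar>\<theta>1 t\<bar> \<le> B1" "AE t in lebesgue_on {0..}. \<bar>\<theta>2 t\<bar> \<le> B2"
      and [measurable]: "\<theta>1 \<in> borel_measurable (lebesgue_on {0..})" "\<theta>2 \<in> borel_measurable (lebesgue_on {0..})"
      using theta_Linf unfolding in_Linf_def by blast
    have "\<theta> \<in> borel_measurable (lebesgue_on {0..})" unfolding \<theta>_def by measurable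
    moreover have "AE t in lebesgue_on {0..}. \<bar>\<theta> t\<bar> \<le> B1 + B2"
      using B
    proof eventually_elim
      case (elim t)
      have "\<bar>\<theta> t\<bar> \<le> \<bar>\<theta>1 t\<bar> + \<bar>\<theta>2 t\<bar>" unfolding \<theta>_def by (simp add: sqrt_sum_squares_le_sum_abs)
      then show ?case using elim by simp
    qed
    ultimately show ?thesis unfolding in_Linf_def by blast
  qed
  have \<Theta>: "\<Theta> = ess_norm \<theta>" unfolding Theta_def \<theta>_def ..
  have \<Theta>0: "\<Theta> \<ge> 0" unfolding \<Theta> by (rule ess_norm_AE(2)[OF \<theta>_Linf])
  have \<theta>_cont: "continuous_on {0..} \<theta>" unfolding \<theta>_def by (intro continuous_intros theta_cont)
  have \<theta>_sq: "(\<theta>1 t)^2 + (\<theta>2 t)^2 \<le> \<Theta>^2" if "t \<ge> 0" for t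
  proof -
    have "\<bar>\<theta> t\<bar> \<le> \<Theta>" unfolding \<Theta> by (rule ess_norm_continuous[OF \<theta>_Linf \<theta>_cont that])
    then have "\<bar>\<theta> t\<bar>^2 \<le> \<Theta>^2" by (intro power_mono) auto
    then show ?thesis unfolding \<theta>_def by simp
  qed
  have \<theta>1_le: "\<bar>\<theta>1 t\<bar> \<le> \<Theta>" and \<theta>2_le: "\<bar>\<theta>2 t\<bar> \<le> \<Theta>" if "t \<ge> 0" for t
  proof -
    have "\<bar>\<theta>1 t\<bar>^2 \<le> \<Theta>^2" "\<bar>\<theta>2 t\<bar>^2 \<le> \<Theta>^2"
      using \<theta>_sq[OF that] zero_le_power2[of "\<theta>1 t"] zero_le_power2[of "\<theta>2 t"] unfolding power2_abs by linarith+
    then show "\<bar>\<theta>1 t\<bar> \<le> \<Theta>" "\<bar>\<theta>2 t\<bar> \<le> \<Theta>" using \<Theta>0 by (auto intro: power2_le_imp_le)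
  qed

  \<comment> \<open>Energy inequality for the heat state and velocity of the output in closed
    loop\<close>
  define n where "n t = (L2norm (w t))^2" for t
  have src: "AE x in lebesgue_on {0..1}. \<bar>wt t x - p * wxx t x\<bar> \<le> \<bar>\<theta>1 t\<bar> * \<bar>y t\<bar>" if "t > 0" for t
  proof -
    have "AE x in lebesgue_on {0..1}. wt t x = p * wxx t x + \<theta>1 t * K x (y t)"
      using pde that by blast
    moreover have "AE x in lebesgue_on {0..1}. \<bar>K x (y t)\<bar> \<le> \<bar>y t\<bar>"
      using K_bound by (intro AE_I2) simp
    ultimately show ?thesis
      by eventually_elim (simp add: abs_mult mult_left_mono)
  qed
  have w_lim: "((\<lambda>s. L2norm (\<lambda>x. (w s x - w t x) / (s - t) - wt t x)) \<longlongrightarrow> 0) (at t)"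
    and w_H2': "H2_with (w t) (wx t) (wxx t)" and bc': "w t 0 = 0 \<and> w t 1 = 0"
    and src_nonneg: "0 \<le> \<bar>\<theta>1 t\<bar> * \<bar>y t\<bar>" if "t > 0" for t
    using wt_deriv w_H2 bc that by auto
  have n_cont: "continuous_on {0..} n"
    and n_ac: "\<And>s r. 0 < s \<Longrightarrow> s \<le> r \<Longrightarrow> abs_cont_on s r n"
    and n_deriv: "\<And>t. t > 0 \<Longrightarrow> \<exists>D. (n has_real_derivative D) (at t) \<and>
          D \<le> - 2 * q * (L2norm (w t))^2 + 2 * (\<bar>\<theta>1 t\<bar> * \<bar>y t\<bar> * L2norm (w t))"
    unfolding n_def q_def
    by (rule heat_L2norm_power2[where wt = wt and wx = wx and wxx = wxx and p = p and m = "\<lambda>t. \<bar>\<theta>1 t\<bar> * \<bar>y t\<bar>"];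
        (assumption | rule w_C0 w_lim wt_cont w_H2' bc' p_pos src_nonneg src)+)+
  obtain N1 where N1: "negligible N1" "\<And>t. t \<in> {0<..} \<Longrightarrow> t \<notin> N1 \<Longrightarrow>
      (y has_real_derivative (u t + \<theta>2 t * L (w t) + d t)) (at t)"
    using AE_lebesgue_on_obtain_negligible[OF ode_y] by auto
  obtain N2 where N2: "negligible N2" "\<And>t. t \<in> {0..} \<Longrightarrow> t \<notin> N2 \<Longrightarrow> \<bar>d t\<bar> \<le> D"
    using AE_lebesgue_on_obtain_negligible[OF ess_norm_AE(1)[OF d_Linf]] unfolding D_def by auto
  define N where "N = N1 \<union> N2"
  have N: "negligible N" unfolding N_def using N1 N2 by simp
  define B where "B t = b + exp (z t)" for t
  have B: "b \<le> B t" for t unfolding B_def by simp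
  define v where "v t = - c * (1 + B t^7 / (4 * a^6)) * (y t^7 + y t^3 + y t) + \<theta>2 t * L (w t) + d t" for t
  have y_deriv: "(y has_real_derivative v t) (at t)" and d_le: "\<bar>d t\<bar> \<le> D" if "t > 0" "t \<notin> N" for t
    using N1(2)[of t] N2(2)[of t] that u_def unfolding N_def v_def B_def by auto
  have L_le: "\<bar>L (w t)\<bar> \<le> L2norm (w t)" if "t > 0" for t
    using L_bound w_H2 bc that unfolding H2_H01_def by blast
  note ab = a_pos a_le b_ge

  \<comment> \<open>Decay of the total energy\<close>
  define W where "W t = n t + (y t)^2" for t
  define CW where "CW = 2 * a * (D^2 + \<Theta>^8 + 2 / p^2) / b + \<Theta>^4 / (2 * p^2 * pi^4)"
  have CW: "CW \<ge> 0" unfolding CW_def using ab by simp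
  have W_bound: "W t \<le> exp (- \<kappa> * t) * W 0 + CW / \<kappa>" if "t \<ge> 0" for t
  proof -
    have "W t \<le> exp (- \<kappa> * (t - 0)) * (W 0 - CW / \<kappa>) + CW / \<kappa>"
    proof (rule abs_cont_gronwall[OF \<kappa>(1) _ _ N])
      show "continuous_on {0..} W" unfolding W_def by (intro continuous_intros n_cont y_cont)
      show "abs_cont_on s r W" if "0 < s" "s \<le> r" for s r
      proof -
        have "continuous_on {s..r} y" "abs_cont_on s r y"
          using y_cont y_ac that by (auto intro: continuous_on_subset)
        then show ?thesis
          unfolding W_def power2_eq_square using that by (intro abs_cont_on_add n_ac abs_cont_on_mult)
      qed
      fix s :: real assume s: "0 < s" "s \<notin> N"
      obtain D' where D': "(n has_real_derivative D') (at s)"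
        "D' \<le> - 2 * q * (L2norm (w s))^2 + 2 * (\<bar>\<theta>1 s\<bar> * \<bar>y s\<bar> * L2norm (w s))"
        using n_deriv[OF s(1)] by blast
      have "(W has_real_derivative D' + 2 * y s * v s) (at s)"
        unfolding W_def using D'(1) y_deriv[OF s] by (auto intro!: derivative_eq_intros)
      moreover have "D' + 2 * y s * v s \<le> - \<kappa> * W s + CW"
        unfolding v_def W_def CW_def n_def using s
        by (intro total_energy_decay[OF p_pos q_def c_ge ab B _ L_le d_le \<kappa>(2,3) D'(2)] \<theta>_sq) auto
      ultimately show "\<exists>D. (W has_real_derivative D) (at s) \<and> D \<le> - \<kappa> * W s + CW" by blast
    qed (use that in auto)
    also have "exp (- \<kappa> * (t - 0)) * (W 0 - CW / \<kappa>) \<le> exp (- \<kappa> * (t - 0)) * W 0"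
      using CW \<kappa> by (intro mult_left_mono) auto
    finally show ?thesis by simp
  qed
  have W0: "W 0 = (L2norm (w 0))^2 + (y 0)^2" unfolding W_def n_def ..
  have W0_nonneg: "W 0 \<ge> 0" unfolding W0 by simp
  have CW_\<kappa>: "CW / \<kappa> = 2 * a * (D^2 + \<Theta>^8 + 2 / p^2) / (b * \<kappa>) + \<Theta>^4 / (2 * p^2 * pi^4 * \<kappa>)"
    unfolding CW_def by (simp add: add_divide_distrib)
  have part1: "(L2norm (w t))^2 + (y t)^2
            \<le> exp (- \<kappa> * t) * ((L2norm (w 0))^2 + (y 0)^2)
              + 2 * a * (D^2 + \<Theta>^8 + 2 / p^2) / (b * \<kappa>)
              + \<Theta>^4 / (2 * p^2 * pi^4 * \<kappa>)" if "t \<ge> 0" for t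
    using W_bound[OF that] unfolding CW_\<kappa> W0 unfolding W_def n_def by simp

  \<comment> \<open>Output inequality with a residue divided by the gain\<close>
  define S where "S = W 0 + 2 * a * (D^2 + \<Theta>^8 + 2 / p^2) / (b * \<kappa>) + \<Theta>^4 / (2 * p^2 * pi^4 * \<kappa>)"
  have n_le: "(L2norm (w t))^2 \<le> S" if "t \<ge> 0" for t
  proof -
    have "W t \<le> exp (- \<kappa> * t) * W 0 + CW / \<kappa>" by (rule W_bound[OF that])
    also have "exp (- \<kappa> * t) * W 0 \<le> 1 * W 0"
      using that \<kappa> W0_nonneg by (intro mult_right_mono) auto
    finally have "W t \<le> S" unfolding S_def CW_\<kappa> by simp
    then show ?thesis unfolding W_def n_def using zero_le_power2[of "y t"] by linarith
  qed
  \<comment> \<open>The constant \<open>C\<close> of the overview; \<open>S\<close> bounds the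
    squared norm of \<open>w\<close> at all times, so \<open>C\<close> does not depend on
    time.\<close>
  define C where "C = D^2 + q / 2 * S + \<Theta>^4 / (4 * q^2)"
  define M where "M = D^2 + \<Theta>^4 + \<Theta>^8 + 2 / p^2 + W 0"
  have S0: "S \<ge> 0" using n_le[of 0] zero_le_power2[of "L2norm (w 0)"] by linarith
  have C0: "C \<ge> 0" unfolding C_def using S0 q0 by simp
  have C_le: "C \<le> Kbar * M"
    unfolding C_def S_def M_def Kbar_def
    by (rule disturbance_gain_le[OF p_pos q_def \<kappa>(1,2) a_pos b_ge W0_nonneg])
  have y_decay: "y t * v t \<le> - c * (y t)^2 + a / (b + exp (z t)) * C" if "t > 0" "t \<notin> N" for t
    unfolding C_def v_def B_def[symmetric] using that
    by (intro output_energy_decay[OF q0 c_ge ab B \<theta>2_le L_le d_le n_le]) auto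

  \<comment> \<open>Boundedness of the gain\<close>
  have z_cont: "continuous_on {0..} z"
  proof -
    obtain z' where "\<forall>t\<ge>0. (z has_real_derivative z' t) (at t within {0..})" using z_C1 by blast
    then show ?thesis by (intro DERIV_continuous_on[of _ z z']) auto
  qed
  interpret adaptive_gain y z \<Gamma> \<epsilon> N
    using Gamma_pos eps_pos y_cont y_ac N z_cont ode_z by unfold_locales auto
  have gain: "exp (z t) \<le> exp (z 0) + Bbar * M" if t: "t \<ge> 0" for t
  proof -
    have "exp (z t) \<le> exp (z 0) + a * C / (2 * c * \<epsilon>) + \<Gamma> / (4 * c) * ((y 0)^2 + a * C / c)"
    proof (rule gain_bound[OF _ a_pos b_ge C0 _ t])
      show "\<exists>v. (y has_real_derivative v) (at s) \<and> y s * v \<le> - c * (y s)^2 + a / (b + exp (z s)) * C"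
        if "0 < s" "s \<notin> N" for s
        using y_deriv[OF that] y_decay[OF that] by blast
    qed (use c_ge in auto)
    also have "\<dots> \<le> exp (z 0) + a * (Kbar * M) / (2 * c * \<epsilon>) + \<Gamma> / (4 * c) * (M + a * (Kbar * M) / c)"
    proof -
      have "(y 0)^2 \<le> M"
        using zero_le_power2[of "L2norm (w 0)"] unfolding M_def W0 by simp
      then show ?thesis
        using C_le a_pos c_ge eps_pos Gamma_pos
        by (intro add_mono mult_left_mono divide_right_mono order_refl) auto
    qed
    \<comment> \<open>So \<open>Bbar\<close> collects the threshold, with coefficient
      \<open>a * Kbar / (2 * c * \<epsilon>)\<close>, and the overshoot after reaching it, with
      coefficient \<open>\<Gamma> / (4 * c) * (1 + a * Kbar / c)\<close>.\<close>
    also have "\<dots> = exp (z 0) + Bbar * M"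
      unfolding Bbar_def using c_ge eps_pos by (simp add: field_simps power2_eq_square)
    finally show ?thesis .
  qed
  have part2: "z 0 \<le> z t \<and> z t \<le> ln (exp (z 0) + Bbar * (D^2 + \<Theta>^4 + \<Theta>^8 + 2 / p^2
                                           + (L2norm (w 0))^2 + (y 0)^2))" if t: "t \<ge> 0" for t
  proof
    show "z 0 \<le> z t" using gain_mono[of 0 t] t by simp
    have "ln (exp (z t)) \<le> ln (exp (z 0) + Bbar * M)"
      using gain[OF t] exp_gt_zero[of "z t"] by (intro ln_mono) linarith+
    then show "z t \<le> ln (exp (z 0) + Bbar * (D^2 + \<Theta>^4 + \<Theta>^8 + 2 / p^2
        + (L2norm (w 0))^2 + (y 0)^2))"
      unfolding M_def W0 by (simp add: add.assoc)
  qed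

  \<comment> \<open>Limit superior of the output\<close>
  define s0 where "s0 = sqrt (2 * \<epsilon>)"
  have s0: "s0 > 0" "s0^2 = 2 * \<epsilon>" unfolding s0_def using eps_pos by auto
  have y_ev: "\<forall>\<^sub>F t in at_top. \<bar>y t\<bar> \<le> s0 + \<delta>" if \<delta>: "\<delta> > 0" for \<delta>
  proof -
    \<comment> \<open>Chosen so that \<open>\<epsilon> + \<eta>\<close> is half the square of
      \<open>s0 + \<delta>\<close>.\<close>
    define \<eta> where "\<eta> = ((s0 + \<delta>)^2 - s0^2) / 2"
    have \<eta>: "\<eta> > 0" unfolding \<eta>_def using \<delta> s0(1) by (simp add: power2_sum add_pos_pos)
    have bound: "y t * v t \<le> a * C + 1" if "t > 0" "t \<notin> N" for t
    proof -
      have "1 \<le> b + exp (z t)" using b_ge exp_ge_zero[of "z t"] by linarith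
      then have "a / (b + exp (z t)) \<le> a / 1" using a_pos by (intro divide_left_mono) auto
      then have "a / (b + exp (z t)) * C \<le> a * C" using C0 mult_right_mono by fastforce
      moreover have "0 \<le> c * (y t)^2" using c_ge by simp
      ultimately show ?thesis using y_decay[OF that] by simp
    qed
    \<comment> \<open>The added 1 keeps the rate positive even if \<open>C = 0\<close>.\<close>
    have R: "a * C + 1 > 0" using a_pos C0 by (simp add: add_nonneg_pos)
    have "\<forall>\<^sub>F t in at_top. (y t)^2 / 2 \<le> \<epsilon> + \<eta>"
    proof (rule output_eventually_small[OF R \<eta>])
      show "\<exists>v. (y has_real_derivative v) (at t) \<and> y t * v \<le> a * C + 1" if "0 < t" "t \<notin> N" for t
        using y_deriv[OF that] bound[OF that] by blast
    qed (rule gain)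
    then show ?thesis
    proof eventually_elim
      case (elim t)
      then have "\<bar>y t\<bar>^2 \<le> (s0 + \<delta>)^2" using s0(2) unfolding \<eta>_def by (simp add: field_simps)
      then show ?case by (rule power2_le_imp_le) (use s0 \<delta> in simp)
    qed
  qed
  have part4: "Limsup at_top (\<lambda>t. ereal \<bar>y t\<bar>) \<le> ereal (sqrt (2 * \<epsilon>))"
  proof (rule ereal_le_epsilon2)
    fix e :: real assume "0 < e"
    then show "Limsup at_top (\<lambda>t. ereal \<bar>y t\<bar>) \<le> ereal (sqrt (2 * \<epsilon>)) + ereal e"
      using y_ev[of e] unfolding s0_def by (intro Limsup_bounded) auto
  qed

  \<comment> \<open>Limit superior of the heat state\<close>
  have part3: "Limsup at_top (\<lambda>t. ereal (L2norm (w t)))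
            \<le> ereal (sqrt (2 * \<epsilon>) / (p * pi^2)) * Limsup at_top (\<lambda>t. ereal \<bar>\<theta>1 t\<bar>)"
  proof -
    let ?A = "Limsup at_top (\<lambda>t. ereal \<bar>\<theta>1 t\<bar>)"
    \<comment> \<open>The limit superior of the parameter is finite and nonnegative, so the product
      in the claim is one of reals.\<close>
    have "\<forall>\<^sub>F t in at_top. ereal \<bar>\<theta>1 t\<bar> \<le> ereal \<Theta>"
      using eventually_ge_at_top[of "0::real"] by eventually_elim (simp add: \<theta>1_le)
    then have "?A \<le> ereal \<Theta>" by (rule Limsup_bounded)
    moreover have "0 \<le> ?A"
      by (intro le_Limsup) auto
    ultimately obtain \<alpha> where \<alpha>: "?A = ereal \<alpha>" "\<alpha> \<ge> 0" by (cases ?A) auto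
    have "Limsup at_top (\<lambda>t. ereal (L2norm (w t))) \<le> ereal (s0 / q * \<alpha>)"
    proof (rule ereal_le_epsilon2)
      fix e :: real assume e: "0 < e"
      \<comment> \<open>The cap at 1 turns the excess
        \<open>\<delta> * (s0 + \<alpha> + \<delta>)\<close> of \<open>m\<close> over
        \<open>s0 * \<alpha>\<close> into one linear in \<open>\<delta>\<close>, at most
        \<open>q * e / 2\<close>.\<close>
      define \<delta> where "\<delta> = min 1 (q * e / (2 * (s0 + \<alpha> + 1)))"
      have \<delta>: "\<delta> > 0" "\<delta> \<le> 1" "\<delta> * (s0 + \<alpha> + 1) \<le> q * e / 2"
      proof -
        have "\<delta> * (s0 + \<alpha> + 1) \<le> q * e / (2 * (s0 + \<alpha> + 1)) * (s0 + \<alpha> + 1)"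
          unfolding \<delta>_def using s0 \<alpha> by (intro mult_right_mono) auto
        also have "\<dots> = q * e / 2" using s0(1) \<alpha>(2) by (simp add: field_simps)
        finally show "\<delta> * (s0 + \<alpha> + 1) \<le> q * e / 2" .
      qed (use q0 e s0 \<alpha> in \<open>auto simp: \<delta>_def\<close>)
      define m where "m = (\<alpha> + \<delta>) * (s0 + \<delta>)"
      have m0: "m \<ge> 0" unfolding m_def using \<alpha> \<delta> s0 by simp
      have m_le: "m / q + e / 2 \<le> s0 / q * \<alpha> + e"
      proof -
        have "m = s0 * \<alpha> + \<delta> * (s0 + \<alpha> + \<delta>)" unfolding m_def by (simp add: algebra_simps)
        also have "\<delta> * (s0 + \<alpha> + \<delta>) \<le> \<delta> * (s0 + \<alpha> + 1)" using \<delta> by (intro mult_left_mono) auto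
        also have "\<dots> \<le> q * e / 2" by (rule \<delta>)
        finally have "m / q \<le> (s0 * \<alpha> + q * e / 2) / q" using q0 by (intro divide_right_mono) auto
        also have "\<dots> = s0 / q * \<alpha> + e / 2" using q0 by (simp add: add_divide_distrib)
        finally show ?thesis by simp
      qed
      have "?A < ereal (\<alpha> + \<delta>)" unfolding \<alpha> using \<delta> by simp
      then have "\<forall>\<^sub>F t in at_top. \<bar>\<theta>1 t\<bar> < \<alpha> + \<delta>" using Limsup_lessD by force
      moreover have "\<forall>\<^sub>F t in at_top. \<bar>y t\<bar> \<le> s0 + \<delta>" by (rule y_ev[OF \<delta>(1)])
      moreover have "\<forall>\<^sub>F t in at_top. t \<ge> (0::real)" by (rule eventually_ge_at_top)
      ultimately have "\<forall>\<^sub>F t in at_top. \<bar>\<theta>1 t\<bar> * \<bar>y t\<bar> \<le> m \<and> t \<ge> 0"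
      proof eventually_elim
        case (elim t)
        then show ?case unfolding m_def using \<alpha> \<delta> by (auto intro!: mult_mono)
      qed
      then obtain T where T: "\<And>t. t \<ge> T \<Longrightarrow> \<bar>\<theta>1 t\<bar> * \<bar>y t\<bar> \<le> m \<and> t \<ge> 0"
        unfolding eventually_at_top_linorder by blast
      have T0: "T \<ge> 0" using T by blast
      \<comment> \<open>Half of the dissipation pays for the source by Young's inequality. This
        costs decay rate but not sharpness: the equilibrium is \<open>(m / q)^2\<close>, as for the
        original inequality.\<close>
      have n_exp: "n t \<le> exp (- q * (t - T)) * (n T - m^2 / q / q) + m^2 / q / q" if "t \<ge> T" for t
      proof (rule abs_cont_gronwall[OF q0 _ _ negligible_empty])
        show "continuous_on {T..} n" using T0 by (intro continuous_on_subset[OF n_cont]) auto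
        show "abs_cont_on s r n" if "T < s" "s \<le> r" for s r using that T0 by (intro n_ac) auto
        fix s assume s: "T < s"
        obtain D' where D': "(n has_real_derivative D') (at s)"
          "D' \<le> - 2 * q * (L2norm (w s))^2 + 2 * (\<bar>\<theta>1 s\<bar> * \<bar>y s\<bar> * L2norm (w s))"
          using n_deriv[of s] s T0 by auto
        have "\<bar>\<theta>1 s\<bar> * \<bar>y s\<bar> * L2norm (w s) \<le> m * L2norm (w s)"
          using T[of s] s by (intro mult_right_mono L2norm_nonneg) auto
        moreover have "2 * L2norm (w s) * m \<le> q * (L2norm (w s))^2 + m^2 / q"
          by (rule weighted_young[OF q0])
        ultimately have "D' \<le> - q * n s + m^2 / q" using D'(2) unfolding n_def by (simp add: mult_ac)
        then show "\<exists>D. (n has_real_derivative D) (at s) \<and> D \<le> - q * n s + m^2 / q" using D'(1) by blast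
      qed (rule that)
      have "((\<lambda>t. exp (- q * (t - T)) * (n T - m^2 / q / q) + m^2 / q / q) \<longlongrightarrow> 0 * (n T - m^2 / q / q) + m^2 / q / q) at_top"
      proof (intro tendsto_intros)
        have "filterlim (\<lambda>t. - T + t) at_top at_top"
          by (rule filterlim_tendsto_add_at_top[OF tendsto_const filterlim_ident])
        then have "filterlim (\<lambda>t. - q * (- T + t)) at_bot at_top"
          using q0 by (intro filterlim_tendsto_neg_mult_at_bot[OF tendsto_const]) auto
        then show "((\<lambda>t. exp (- q * (t - T))) \<longlongrightarrow> 0) at_top"
          using filterlim_compose[OF exp_at_bot] by (simp add: add.commute)
      qed
      moreover have "0 * (n T - m^2 / q / q) + m^2 / q / q < (m / q + e / 2)^2"
        using e m0 q0 by (simp add: power2_sum power_divide power2_eq_square[of q] add_pos_nonneg)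
      ultimately have "\<forall>\<^sub>F t in at_top. exp (- q * (t - T)) * (n T - m^2 / q / q) + m^2 / q / q < (m / q + e / 2)^2"
        by (rule order_tendstoD)
      then have "\<forall>\<^sub>F t in at_top. ereal (L2norm (w t)) \<le> ereal (s0 / q * \<alpha>) + ereal e"
        using eventually_ge_at_top[of T]
      proof eventually_elim
        case (elim t)
        then have "(L2norm (w t))^2 \<le> (m / q + e / 2)^2" using n_exp[of t] unfolding n_def by simp
        then have "L2norm (w t) \<le> m / q + e / 2" by (rule power2_le_imp_le) (use m0 q0 e in simp)
        then show ?case using m_le by simp
      qed
      then show "Limsup at_top (\<lambda>t. ereal (L2norm (w t))) \<le> ereal (s0 / q * \<alpha>) + ereal e"
        by (rule Limsup_bounded)
    qed
    then show ?thesis unfolding \<alpha> s0_def q_def by simp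
  qed
  show ?thesis using part1 part2 part3 part4 by blast
qed

end
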